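(* For every positive integer $k$, the set of $k$-critical $(P_5,\overline{P}_5)$-free graphs (up to isomorphism) is finite.
   Context: All graphs are finite and simple. A graph is $(P_5,\overline{P}_5)$-free if it contains no induced subgraph isomorphic to the path $P_5$ on five vertices or to its complement $\overline{P}_5$. A graph is $k$-critical if its chromatic number is $k$ and every proper induced subgraph is $(k-1)$-colorable. *)

theory Defs
  imports "Graph_Theory.Graph_Theory"
begin

text \<open>
  A finite simple graph is a \<^locale>\<open>pair_graph\<close>: a finite, loop-free digraph with a symmetric arc
  set, so that an edge \<open>uv\<close> is the pair of arcs \<open>(u,v)\<close> and \<open>(v,u)\<close>. Isomorphism
  (\<^const>\<open>digraph_iso\<close>) and induced subgraphs (\<^const>\<open>induced_subgraph\<close>) are those of the
  underlying \<^const>\<open>with_proj\<close> digraphs.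
\<close>

definition path_graph :: "nat \<Rightarrow> nat pair_pre_digraph" where
  "path_graph n = \<lparr> pverts = {..<n},
     parcs = {(i, j). i < n \<and> j < n \<and> (j = Suc i \<or> i = Suc j)} \<rparr>"

definition complement_graph :: "'a pair_pre_digraph \<Rightarrow> 'a pair_pre_digraph" where
  "complement_graph G = \<lparr> pverts = pverts G,
     parcs = {(u, v). u \<in> pverts G \<and> v \<in> pverts G \<and> u \<noteq> v \<and> (u, v) \<notin> parcs G} \<rparr>"

definition induced_free :: "'b pair_pre_digraph \<Rightarrow> 'a pair_pre_digraph \<Rightarrow> bool" where
  "induced_free F G \<longleftrightarrow>
     \<not> (\<exists>H :: 'a pair_pre_digraph. induced_subgraph (with_proj H) (with_proj G) \<and>
           digraph_iso (with_proj H) (with_proj F))"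

definition P5_coP5_free :: "'a pair_pre_digraph \<Rightarrow> bool" where
  "P5_coP5_free G \<longleftrightarrow>
     induced_free (path_graph 5) G \<and> induced_free (complement_graph (path_graph 5)) G"

definition colorable :: "nat \<Rightarrow> 'a pair_pre_digraph \<Rightarrow> bool" where
  "colorable k G \<longleftrightarrow>
     (\<exists>c :: 'a \<Rightarrow> nat. (\<forall>v \<in> pverts G. c v < k) \<and> (\<forall>(u, v) \<in> parcs G. c u \<noteq> c v))"

definition chromatic_number :: "'a pair_pre_digraph \<Rightarrow> nat" where
  "chromatic_number G = (LEAST k. colorable k G)"

definition critical :: "nat \<Rightarrow> 'a pair_pre_digraph \<Rightarrow> bool" where
  "critical k G \<longleftrightarrow>
     chromatic_number G = k \<and>
     (\<forall>H :: 'a pair_pre_digraph.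
        induced_subgraph (with_proj H) (with_proj G) \<and> H \<noteq> G \<longrightarrow> colorable (k - 1) H)"

definition graph_iso_rel :: "('a pair_pre_digraph \<times> 'a pair_pre_digraph) set" where
  "graph_iso_rel =
     {(G, H). pair_graph G \<and> pair_graph H \<and> digraph_iso (with_proj G) (with_proj H)}"

lemma digraph_iso_with_proj_iff:
  fixes G :: "'a pair_pre_digraph" and H :: "'b pair_pre_digraph"
  assumes G: "pair_wf_digraph G"
  shows "digraph_iso (with_proj G) (with_proj H) \<longleftrightarrow>
    (\<exists>f. bij_betw f (pverts G) (pverts H) \<and> parcs H = map_prod f f ` parcs G)"
proof
  assume "digraph_iso (with_proj G) (with_proj H)"
  then obtain h where h: "pre_digraph.digraph_isomorphism (with_proj G) h"
    and H: "with_proj H = app_iso h (with_proj G)"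
    unfolding digraph_iso_def by auto
  have inj: "inj_on (iso_verts h) (pverts G)"
    and arc: "\<forall>a\<in>parcs G. iso_verts h (fst a) = iso_tail h (iso_arcs h a) \<and>
                           iso_verts h (snd a) = iso_head h (iso_arcs h a)"
    using h unfolding pre_digraph.digraph_isomorphism_def by auto
  have H': "pverts H = iso_verts h ` pverts G" "parcs H = iso_arcs h ` parcs G"
    "iso_tail h = fst" "iso_head h = snd"
    using H unfolding with_proj_def app_iso_def by auto
  have "iso_arcs h a = map_prod (iso_verts h) (iso_verts h) a" if "a \<in> parcs G" for a
    using arc that H'(3,4) by (intro prod_eqI) auto
  then have "parcs H = map_prod (iso_verts h) (iso_verts h) ` parcs G"
    using H'(2) by (auto simp: image_def)
  then show "\<exists>f. bij_betw f (pverts G) (pverts H) \<and> parcs H = map_prod f f ` parcs G"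
    using inj H'(1) unfolding bij_betw_def by blast
next
  assume "\<exists>f. bij_betw f (pverts G) (pverts H) \<and> parcs H = map_prod f f ` parcs G"
  then obtain f where f: "inj_on f (pverts G)" "pverts H = f ` pverts G"
    "parcs H = map_prod f f ` parcs G"
    unfolding bij_betw_def by auto
  interpret pair_wf_digraph G by fact
  let ?h = "\<lparr> iso_verts = f, iso_arcs = map_prod f f, iso_head = snd, iso_tail = fst \<rparr>"
  have "parcs G \<subseteq> pverts G \<times> pverts G"
    by (auto dest: in_arcsD1 in_arcsD2)
  then have "inj_on (map_prod f f) (parcs G)"
    using map_prod_inj_on[OF f(1) f(1)] inj_on_subset by blast
  moreover have "wf_digraph (with_proj G)"
    by (rule wf_digraph)
  ultimately have "pre_digraph.digraph_isomorphism (with_proj G) ?h"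
    using f(1) unfolding pre_digraph.digraph_isomorphism_def by auto
  moreover have "with_proj H = app_iso ?h (with_proj G)"
    using f(2,3) by (simp add: with_proj_def app_iso_def)
  ultimately show "digraph_iso (with_proj G) (with_proj H)"
    unfolding digraph_iso_def by blast
qed

lemma equiv_graph_iso_rel: "equiv {G :: 'a pair_pre_digraph. pair_graph G} graph_iso_rel"
proof -
  have wf: "pair_wf_digraph G" if "pair_graph G" for G :: "'a pair_pre_digraph"
    using that by (simp add: pair_graph_def pair_digraph_def pair_fin_digraph_def)
  have refl: "digraph_iso (with_proj G) (with_proj G)" if "pair_graph G"
    for G :: "'a pair_pre_digraph"
    unfolding digraph_iso_with_proj_iff[OF wf[OF that]]
    by (rule exI[where x = id]) (simp_all add: prod.map_id0)
  have sym: "digraph_iso (with_proj H) (with_proj G)"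
    if "pair_graph G" "digraph_iso (with_proj G) (with_proj H)"
    for G H :: "'a pair_pre_digraph"
    using digraph_iso_swap[OF _ that(2)] wf[OF that(1)]
    by (simp add: wf_digraph_wp_iff)
  show ?thesis
    by (rule equivI)
      (auto simp: graph_iso_rel_def refl_on_def sym_def trans_def intro: refl sym digraph_iso_trans)
qed

end

theory Submission
  imports Defs
begin

text \<open>
  A module \<open>M\<close> of a critical graph induces a critical graph, and if \<open>M\<close> is proper then its chromatic
  number is smaller. So it suffices to cover every critical \<open>(P5, co-P5)\<close>-free graph with more than one
  vertex by at most five proper modules: the number of vertices is then at most \<open>5 ^ k\<close>.

  Without induced \<open>C5\<close>, ordering the vertices by decreasing degree is a perfect order in the sense of
  Chvatal, so greedy colouring is optimal and a critical graph is complete. With an induced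
  \<open>C5\<close>, the vertices that can stand in for a given vertex of the cycle form a module, and so does the
  union \<open>B\<close> of these five modules (Fouquet). If \<open>B\<close> is the whole graph we are done; otherwise turn
  \<open>\<chi>(B)\<close> vertices of \<open>B\<close> into a clique, delete the rest of \<open>B\<close>, and lift a cover of the resulting smaller
  critical graph.
\<close>

section \<open>Colourings and modules\<close>

definition colorable_on :: "('a \<Rightarrow> 'a \<Rightarrow> bool) \<Rightarrow> 'a set \<Rightarrow> nat \<Rightarrow> bool" where
  "colorable_on E V n \<longleftrightarrow>
     (\<exists>c. c ` V \<subseteq> {..<n} \<and> (\<forall>u\<in>V. \<forall>v\<in>V. E u v \<longrightarrow> c u \<noteq> c v))"

text \<open>Deleting single vertices covers all proper induced subgraphs: each lies in some
  \<open>V - {v}\<close>, and colourability passes to subsets.\<close>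

definition critical_on :: "('a \<Rightarrow> 'a \<Rightarrow> bool) \<Rightarrow> 'a set \<Rightarrow> nat \<Rightarrow> bool" where
  "critical_on E V k \<longleftrightarrow> colorable_on E V k \<and> (\<forall>j<k. \<not> colorable_on E V j) \<and>
     (\<forall>v\<in>V. colorable_on E (V - {v}) (k - 1))"

text \<open>Modules in the usual sense: as \<open>u\<close> and \<open>v\<close> can be swapped, the
  implication is an equivalence. The empty set and \<open>V\<close> itself qualify; properness is
  demanded separately.\<close>

definition homogeneous :: "('a \<Rightarrow> 'a \<Rightarrow> bool) \<Rightarrow> 'a set \<Rightarrow> 'a set \<Rightarrow> bool" where
  "homogeneous E V M \<longleftrightarrow> M \<subseteq> V \<and> (\<forall>y\<in>V - M. \<forall>u\<in>M. \<forall>v\<in>M. E y u \<longrightarrow> E y v)"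

lemma colorable_on_mono:
  assumes "colorable_on E V n" "W \<subseteq> V" "n \<le> m"
  shows "colorable_on E W m"
proof -
  obtain c where "c ` V \<subseteq> {..<n}" "\<forall>u\<in>V. \<forall>v\<in>V. E u v \<longrightarrow> c u \<noteq> c v"
    using assms(1) unfolding colorable_on_def by blast
  then show ?thesis
    unfolding colorable_on_def using assms(2,3) by (intro exI[of _ c]) fastforce
qed

lemma colorable_on_0_iff: "colorable_on E V 0 \<longleftrightarrow> V = {}"
  unfolding colorable_on_def by auto

lemma colorable_on_card_image:
  fixes c :: "'a \<Rightarrow> 'b"
  assumes "finite V" and c: "\<forall>u\<in>V. \<forall>v\<in>V. E u v \<longrightarrow> c u \<noteq> c v"
  shows "colorable_on E V (card (c ` V))"
proof -
  obtain h where h: "bij_betw h (c ` V) {0..<card (c ` V)}"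
    using ex_bij_betw_finite_nat[of "c ` V"] assms(1) by blast
  have "(h \<circ> c) ` V \<subseteq> {..<card (c ` V)}"
    using h unfolding bij_betw_def by (auto simp: image_comp[symmetric])
  moreover have "(h \<circ> c) u \<noteq> (h \<circ> c) v" if "u \<in> V" "v \<in> V" "E u v" for u v
    using h c that unfolding bij_betw_def inj_on_def by auto
  ultimately show ?thesis
    unfolding colorable_on_def by blast
qed

lemma colorable_on_card_le:
  assumes "finite V" "irreflp E" "card V \<le> n"
  shows "colorable_on E V n"
proof -
  have "colorable_on E V (card (id ` V))"
    using assms(1,2) by (intro colorable_on_card_image) (auto simp: irreflp_def)
  then show ?thesis
    using assms(3) by (auto intro: colorable_on_mono)
qed

lemma colorable_on_Suc:
  assumes "colorable_on E (V - {v}) n" "irreflp E"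
  shows "colorable_on E V (Suc n)"
proof -
  obtain c where c: "c ` (V - {v}) \<subseteq> {..<n}" "\<forall>x\<in>V - {v}. \<forall>y\<in>V - {v}. E x y \<longrightarrow> c x \<noteq> c y"
    using assms(1) unfolding colorable_on_def by blast
  have 1: "c x < n" if "x \<in> V" "x \<noteq> v" for x
    using c(1) that by auto
  show ?thesis
    unfolding colorable_on_def
  proof (intro exI[of _ "c(v := n)"] conjI ballI impI)
    show "(c(v := n)) ` V \<subseteq> {..<Suc n}"
      using 1 by (auto simp: less_Suc_eq)
  next
    fix x y assume "x \<in> V" "y \<in> V" "E x y"
    then show "(c(v := n)) x \<noteq> (c(v := n)) y"
      using 1[of x] 1[of y] c(2) assms(2) by (auto simp: irreflp_def)
  qed
qed

lemma colorable_on_nonadjacent: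
  assumes "finite V" "irreflp E" "symp E" "x \<in> V" "y \<in> V" "x \<noteq> y" "\<not> E x y"
  shows "colorable_on E V (card V - 1)"
proof -
  \<comment> \<open>Every vertex is its own colour, except that \<open>y\<close> borrows the colour
    of \<open>x\<close>.\<close>
  have "colorable_on E V (card ((id(y := x)) ` V))"
    using assms by (intro colorable_on_card_image) (auto simp: irreflp_def dest: sympD)
  moreover have "(id(y := x)) ` V = V - {y}"
    using assms by (auto simp: image_iff)
  ultimately show ?thesis
    using assms by simp
qed

text \<open>A set \<open>M\<close> attached to \<open>R\<close> like a module can be exchanged for another set \<open>N\<close>,
  coloured with the colours that \<open>M\<close> used.\<close>

lemma recolor:
  assumes "finite M" and N: "colorable_on E' N (card (c ` M))"
    and c: "c ` (R \<union> M) \<subseteq> {..<n}" "\<forall>u\<in>R \<union> M. \<forall>v\<in>R \<union> M. E u v \<longrightarrow> c u \<noteq> c v"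
    and "R \<inter> N = {}" "symp E'"
    and R: "\<And>u v. u \<in> R \<Longrightarrow> v \<in> R \<Longrightarrow> E' u v \<Longrightarrow> E u v"
    and RN: "\<And>u v w. u \<in> R \<Longrightarrow> v \<in> N \<Longrightarrow> E' u v \<Longrightarrow> w \<in> M \<Longrightarrow> E u w"
  shows "colorable_on E' (R \<union> N) n"
proof -
  obtain d where d: "d ` N \<subseteq> {..<card (c ` M)}" "\<forall>u\<in>N. \<forall>v\<in>N. E' u v \<longrightarrow> d u \<noteq> d v"
    using N unfolding colorable_on_def by blast
  obtain h where h: "bij_betw h {0..<card (c ` M)} (c ` M)"
    using ex_bij_betw_nat_finite[of "c ` M"] assms(1) by blast
  have hd: "h (d v) \<in> c ` M" if "v \<in> N" for v
    using bij_betwE[OF h] d(1) that by (simp add: image_subset_iff)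
  have inj: "h (d u) \<noteq> h (d v)" if "u \<in> N" "v \<in> N" "E' u v" for u v
  proof -
    have "d u \<in> {0..<card (c ` M)}" "d v \<in> {0..<card (c ` M)}" "d u \<noteq> d v"
      using d that by auto
    then show ?thesis
      using h unfolding bij_betw_def inj_on_def by blast
  qed
  \<comment> \<open>The new colour of \<open>v\<close> is the old colour of some \<open>w\<close> in
    \<open>M\<close>; \<open>RN\<close> makes \<open>w\<close> an \<open>E\<close>-neighbour of
    \<open>u\<close>, so \<open>c\<close> separates the two.\<close>
  have cross: "c u \<noteq> h (d v)" if uv: "u \<in> R" "v \<in> N" "E' u v" for u v
  proof -
    obtain w where w: "w \<in> M" "h (d v) = c w"
      using hd[OF uv(2)] by blast
    show ?thesis
      using RN[OF uv w(1)] c(2) uv(1) w by auto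
  qed
  let ?c = "\<lambda>v. if v \<in> N then h (d v) else c v"
  show ?thesis
    unfolding colorable_on_def
  proof (intro exI[of _ ?c] conjI ballI impI)
    have "h (d v) < n" if "v \<in> N" for v
      using c(1) hd[OF that] by auto
    then show "?c ` (R \<union> N) \<subseteq> {..<n}"
      using c(1) by auto
  next
    fix u v assume uv: "u \<in> R \<union> N" "v \<in> R \<union> N" "E' u v"
    have vu: "E' v u"
      using uv(3) assms(6) by (rule sympD[rotated])
    show "?c u \<noteq> ?c v"
      using uv vu inj[of u v] cross[of u v] cross[of v u] c(2) R[of u v] assms(5)
      by (cases "u \<in> N"; cases "v \<in> N") (auto dest: not_sym)
  qed
qed

section \<open>Critical graphs and their modules\<close>

lemma critical_on_pos:
  assumes "critical_on E V k" "V \<noteq> {}"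
  shows "0 < k"
  using assms unfolding critical_on_def by (metis colorable_on_0_iff neq0_conv)

lemma critical_on_delete:
  assumes "critical_on E V k" "v \<in> V"
  obtains c where "c ` (V - {v}) \<subseteq> {..<k - 1}"
    "\<forall>x\<in>V - {v}. \<forall>y\<in>V - {v}. E x y \<longrightarrow> c x \<noteq> c y"
proof -
  have "colorable_on E (V - {v}) (k - 1)"
    using assms unfolding critical_on_def by blast
  then show ?thesis
    unfolding colorable_on_def using that by blast
qed

text \<open>\<open>j\<close> is the chromatic number of \<open>M\<close>. If \<open>M - {v}\<close>
  still needed \<open>j\<close> colours, a colouring of \<open>V - {v}\<close> with
  \<open>k - 1\<close> colours would spend at least \<open>j\<close> of them there; sharing these
  out over all of \<open>M\<close> would colour \<open>V\<close> with \<open>k - 1\<close> colours.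
  \<open>j < k\<close> because \<open>M\<close> avoids some vertex of \<open>V\<close>.\<close>

lemma critical_on_homogeneous:
  assumes fin: "finite V" and sym: "symp E" and crit: "critical_on E V k"
    and hom: "homogeneous E V M" and "M \<noteq> V"
  obtains j where "j < k" "critical_on E M j"
proof -
  have MV: "M \<subseteq> V" and M: "\<And>y u v. y \<in> V - M \<Longrightarrow> u \<in> M \<Longrightarrow> v \<in> M \<Longrightarrow> E y u \<Longrightarrow> E y v"
    using hom unfolding homogeneous_def by blast+
  then obtain x where x: "x \<in> V" "x \<notin> M"
    using \<open>M \<noteq> V\<close> by blast
  have finM: "finite M"
    using fin MV by (rule finite_subset[rotated])
  have k: "0 < k"
    using critical_on_pos[OF crit] x by blast
  have colM: "colorable_on E M (k - 1)"
    using crit x MV colorable_on_mono[of E "V - {x}" "k - 1" M "k - 1"]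
    unfolding critical_on_def by blast
  define j where "j = (LEAST n. colorable_on E M n)"
  have j: "colorable_on E M j" "\<And>n. n < j \<Longrightarrow> \<not> colorable_on E M n" "j \<le> k - 1"
    unfolding j_def using colM by (auto intro: LeastI Least_le dest: not_less_Least)
  have "colorable_on E (M - {v}) (j - 1)" if v: "v \<in> M" for v
  proof (rule ccontr)
    assume not: "\<not> colorable_on E (M - {v}) (j - 1)"
    obtain c where c: "c ` (V - {v}) \<subseteq> {..<k - 1}"
      "\<forall>x\<in>V - {v}. \<forall>y\<in>V - {v}. E x y \<longrightarrow> c x \<noteq> c y"
      using critical_on_delete[OF crit, of v] v MV by blast
    have "colorable_on E (M - {v}) (card (c ` (M - {v})))"
      by (rule colorable_on_card_image) (use c(2) MV finM in auto)
    then have "j \<le> card (c ` (M - {v}))"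
      using not colorable_on_mono[OF _ order_refl, of E "M - {v}" "card (c ` (M - {v}))" "j - 1"]
      by linarith
    then have col: "colorable_on E M (card (c ` (M - {v})))"
      using j(1) colorable_on_mono by blast
    have *: "V - M \<union> (M - {v}) = V - {v}"
      using v MV by blast
    have "colorable_on E (V - M \<union> M) (k - 1)"
    proof (rule recolor[OF _ col _ _ _ sym])
      show "c ` (V - M \<union> (M - {v})) \<subseteq> {..<k - 1}"
        "\<forall>x\<in>V - M \<union> (M - {v}). \<forall>y\<in>V - M \<union> (M - {v}). E x y \<longrightarrow> c x \<noteq> c y"
        unfolding * by (fact c)+
    next
      fix y u w assume "y \<in> V - M" "u \<in> M" "E y u" "w \<in> M - {v}"
      then show "E y w"
        using M[of y u w] by blast
    qed (use finM in auto)
    moreover have "V - M \<union> M = V"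
      using MV by blast
    ultimately show False
      using crit k unfolding critical_on_def by auto
  qed
  then have "critical_on E M j"
    unfolding critical_on_def using j by blast
  then show ?thesis
    using that[of j] j(3) k by linarith
qed

section \<open>Replacing a module by a clique\<close>

text \<open>Substitutes a complete graph for a module without new vertices: edges are added inside a
  subset \<open>K\<close> of the module, and the remaining module vertices are dropped from the
  vertex set, not from the relation.\<close>

definition add_clique :: "('a \<Rightarrow> 'a \<Rightarrow> bool) \<Rightarrow> 'a set \<Rightarrow> 'a \<Rightarrow> 'a \<Rightarrow> bool" where
  "add_clique E K u v \<longleftrightarrow> E u v \<or> u \<in> K \<and> v \<in> K \<and> u \<noteq> v"

lemma symp_add_clique: "symp E \<Longrightarrow> symp (add_clique E K)"
  unfolding symp_def add_clique_def by blast

lemma irreflp_add_clique: "irreflp E \<Longrightarrow> irreflp (add_clique E K)"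
  unfolding irreflp_def add_clique_def by blast

text \<open>For the rest of the graph only the number of colours spent on the module matters, and
  \<open>M\<close> and the clique on \<open>K\<close> both need \<open>j\<close>. So
  \<open>recolor\<close> applies in both directions: \<open>K\<close> is traded for \<open>M\<close>
  to show that fewer than \<open>k\<close> colours fail, and \<open>M - {v}\<close> for
  \<open>K - {v}\<close> to colour after a deletion.\<close>

lemma critical_on_add_clique:
  assumes fin: "finite V" and sym: "symp E" and irr: "irreflp E"
    and crit: "critical_on E V k" and hom: "homogeneous E V M" and "M \<noteq> V"
    and critM: "critical_on E M j" and K: "K \<subseteq> M" "card K = j"
  shows "critical_on (add_clique E K) (V - M \<union> K) k"
proof -
  let ?E = "add_clique E K"
  have MV: "M \<subseteq> V" and M: "\<And>y u v. y \<in> V - M \<Longrightarrow> u \<in> M \<Longrightarrow> v \<in> M \<Longrightarrow> E y u \<Longrightarrow> E y v"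
    using hom unfolding homogeneous_def by blast+
  then obtain x where x: "x \<in> V" "x \<notin> M"
    using \<open>M \<noteq> V\<close> by blast
  have finM: "finite M" and finK: "finite K"
    using fin MV K(1) by (auto intro: finite_subset)
  have k: "0 < k"
    using critical_on_pos[OF crit] x by blast
  note sym' = symp_add_clique[OF sym, of K] and irr' = irreflp_add_clique[OF irr, of K]
  have E_iff: "?E y u \<longleftrightarrow> E y u" if "y \<notin> M \<or> u \<notin> M" for y u
    using that K unfolding add_clique_def by blast
  have low: "\<not> colorable_on ?E (V - M \<union> K) i" if "i < k" for i
  proof
    assume "colorable_on ?E (V - M \<union> K) i"
    then obtain c where c: "c ` (V - M \<union> K) \<subseteq> {..<i}"
      "\<forall>x\<in>V - M \<union> K. \<forall>y\<in>V - M \<union> K. ?E x y \<longrightarrow> c x \<noteq> c y"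
      unfolding colorable_on_def by blast
    have "inj_on c K"
      using c(2) unfolding inj_on_def add_clique_def by blast
    then have "card (c ` K) = j"
      using K by (simp add: card_image)
    then have col: "colorable_on E M (card (c ` K))"
      using critM unfolding critical_on_def by simp
    have "colorable_on E (V - M \<union> M) i"
    proof (rule recolor[OF finK col c _ sym])
      fix y u w assume y: "y \<in> V - M" and "u \<in> M" "E y u" "w \<in> K"
      then have "E y w"
        using M[of y u w] K(1) by blast
      then show "?E y w"
        unfolding add_clique_def by blast
    qed (auto simp: add_clique_def)
    moreover have "V - M \<union> M = V"
      using MV by blast
    ultimately show False
      using crit \<open>i < k\<close> unfolding critical_on_def by auto
  qed
  have del: "colorable_on ?E (V - M \<union> K - {v}) (k - 1)" if v: "v \<in> V - M \<union> K" for v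
  proof -
    have "v \<in> V"
      using v K MV by blast
    then obtain c where c: "c ` (V - {v}) \<subseteq> {..<k - 1}"
      "\<forall>x\<in>V - {v}. \<forall>y\<in>V - {v}. E x y \<longrightarrow> c x \<noteq> c y"
      using critical_on_delete[OF crit] by blast
    have colM: "colorable_on E (M - {v}) (card (c ` (M - {v})))"
      by (rule colorable_on_card_image) (use c(2) MV finM in auto)
    \<comment> \<open>Either \<open>v\<close> is in \<open>K\<close>, and then
      \<open>M - {v}\<close> still needs \<open>j - 1\<close> colours while \<open>K - {v}\<close>
      has \<open>j - 1\<close> vertices, or \<open>v\<close> is outside \<open>M\<close>, and both
      numbers are compared with \<open>j\<close>.\<close>
    have card: "card (K - {v}) \<le> card (c ` (M - {v}))"
    proof (cases "v \<in> M")
      case True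
      then have "v \<in> K"
        using v by blast
      have "colorable_on E M (Suc (card (c ` (M - {v}))))"
        using colorable_on_Suc[OF colM irr] .
      then have "j \<le> Suc (card (c ` (M - {v})))"
        using critM unfolding critical_on_def by (meson leI)
      then show ?thesis
        using K \<open>v \<in> K\<close> finK by simp
    next
      case False
      then have "j \<le> card (c ` (M - {v}))"
        using critM colM unfolding critical_on_def by (metis Diff_empty Diff_insert0 leI)
      then show ?thesis
        using K(2) card_Diff1_le[of K v] by linarith
    qed
    have *: "V - M - {v} \<union> (M - {v}) = V - {v}"
      using MV by blast
    have "colorable_on ?E (V - M - {v} \<union> (K - {v})) (k - 1)"
    proof (rule recolor[OF _ colorable_on_card_le[OF _ irr' card] _ _ _ sym'])
      show "c ` (V - M - {v} \<union> (M - {v})) \<subseteq> {..<k - 1}"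
        "\<forall>x\<in>V - M - {v} \<union> (M - {v}). \<forall>y\<in>V - M - {v} \<union> (M - {v}). E x y \<longrightarrow> c x \<noteq> c y"
        unfolding * by (fact c)+
    next
      fix y u w assume y: "y \<in> V - M - {v}" and u: "u \<in> K - {v}" "?E y u" and w: "w \<in> M - {v}"
      have "E y u"
        using E_iff[of y u] y u by blast
      then show "E y w"
        using M[of y u w] K(1) y u w by blast
    next
      fix y u assume "y \<in> V - M - {v}" "u \<in> V - M - {v}" "?E y u"
      then show "E y u"
        using E_iff[of y u] by blast
    qed (use finM finK K(1) in auto)
    moreover have "V - M - {v} \<union> (K - {v}) = V - M \<union> K - {v}"
      by blast
    ultimately show ?thesis
      by simp
  qed
  have "colorable_on ?E (V - M \<union> K) (Suc (k - 1))"
    using colorable_on_Suc[OF del[of x] irr'] x by blast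
  then show ?thesis
    unfolding critical_on_def using low del k by simp
qed

section \<open>Forbidden induced subgraphs\<close>

text \<open>Here and in the next two definitions the five vertices are not declared distinct: for a
  symmetric irreflexive \<open>E\<close> the listed adjacencies force it.\<close>

definition is_P5 :: "('a \<Rightarrow> 'a \<Rightarrow> bool) \<Rightarrow> 'a \<Rightarrow> 'a \<Rightarrow> 'a \<Rightarrow> 'a \<Rightarrow> 'a \<Rightarrow> bool" where
  "is_P5 E a b c d e \<longleftrightarrow> E a b \<and> E b c \<and> E c d \<and> E d e \<and>
     \<not> E a c \<and> \<not> E a d \<and> \<not> E a e \<and> \<not> E b d \<and> \<not> E b e \<and> \<not> E c e"

definition is_coP5 :: "('a \<Rightarrow> 'a \<Rightarrow> bool) \<Rightarrow> 'a \<Rightarrow> 'a \<Rightarrow> 'a \<Rightarrow> 'a \<Rightarrow> 'a \<Rightarrow> bool" where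
  "is_coP5 E a b c d e \<longleftrightarrow> \<not> E a b \<and> \<not> E b c \<and> \<not> E c d \<and> \<not> E d e \<and>
     E a c \<and> E a d \<and> E a e \<and> E b d \<and> E b e \<and> E c e"

definition is_C5 :: "('a \<Rightarrow> 'a \<Rightarrow> bool) \<Rightarrow> 'a \<Rightarrow> 'a \<Rightarrow> 'a \<Rightarrow> 'a \<Rightarrow> 'a \<Rightarrow> bool" where
  "is_C5 E a b c d e \<longleftrightarrow> E a b \<and> E b c \<and> E c d \<and> E d e \<and> E e a \<and>
     \<not> E a c \<and> \<not> E a d \<and> \<not> E b d \<and> \<not> E b e \<and> \<not> E c e"

definition P5_coP5_free_on :: "('a \<Rightarrow> 'a \<Rightarrow> bool) \<Rightarrow> 'a set \<Rightarrow> bool" where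
  "P5_coP5_free_on E V \<longleftrightarrow> (\<forall>a\<in>V. \<forall>b\<in>V. \<forall>c\<in>V. \<forall>d\<in>V. \<forall>e\<in>V.
     \<not> is_P5 E a b c d e \<and> \<not> is_coP5 E a b c d e)"

definition C5_free_on :: "('a \<Rightarrow> 'a \<Rightarrow> bool) \<Rightarrow> 'a set \<Rightarrow> bool" where
  "C5_free_on E V \<longleftrightarrow> (\<forall>a\<in>V. \<forall>b\<in>V. \<forall>c\<in>V. \<forall>d\<in>V. \<forall>e\<in>V. \<not> is_C5 E a b c d e)"

lemma P5_coP5_free_onD:
  assumes "P5_coP5_free_on E V" "a \<in> V" "b \<in> V" "c \<in> V" "d \<in> V" "e \<in> V"
  shows "\<not> is_P5 E a b c d e" "\<not> is_coP5 E a b c d e"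
  using assms unfolding P5_coP5_free_on_def by blast+

lemma C5_free_onD:
  assumes "C5_free_on E V" "a \<in> V" "b \<in> V" "c \<in> V" "d \<in> V" "e \<in> V"
  shows "\<not> is_C5 E a b c d e"
  using assms unfolding C5_free_on_def by blast

definition degree_on :: "('a \<Rightarrow> 'a \<Rightarrow> bool) \<Rightarrow> 'a set \<Rightarrow> 'a \<Rightarrow> nat" where
  "degree_on E V v = card {u \<in> V. E v u}"

text \<open>The private neighbours of \<open>a\<close> against \<open>b\<close> are adjacent to \<open>c\<close> and not to \<open>d\<close>, and
  symmetrically for \<open>d\<close> against \<open>c\<close>; so neither set can be the larger one.\<close>

lemma no_obstruction:
  assumes fin: "finite V" and sym: "symp E" and irr: "irreflp E"
    and free: "P5_coP5_free_on E V" and C5: "C5_free_on E V"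
    and V: "a \<in> V" "b \<in> V" "c \<in> V" "d \<in> V"
    and path: "E a b" "E b c" "E c d" "\<not> E a c" "\<not> E b d" "\<not> E a d"
    and deg: "degree_on E V b \<le> degree_on E V a" "degree_on E V c \<le> degree_on E V d"
  shows False
proof -
  have sym': "E u v = E v u" for u v
    using sym unfolding symp_def by blast
  have priv: "E x c \<and> \<not> E x d"
    if V: "a \<in> V" "b \<in> V" "c \<in> V" "d \<in> V" "x \<in> V"
      and path: "E a b" "E b c" "E c d" "\<not> E a c" "\<not> E b d" "\<not> E a d"
      and x: "E a x" "\<not> E b x" for a b c d x
  proof -
    \<comment> \<open>These exclude the other three cases in turn: \<open>x\<close> adjacent to
      neither \<open>c\<close> nor \<open>d\<close>, to both, and to \<open>d\<close> alone.\<close>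
    have "\<not> is_P5 E x a b c d" "\<not> is_coP5 E x b d a c" "\<not> is_C5 E x a b c d"
      using V by (simp_all add: P5_coP5_free_onD[OF free] C5_free_onD[OF C5])
    then show ?thesis
      using path x unfolding is_P5_def is_coP5_def is_C5_def
      using sym'[of x a] sym'[of x b] sym'[of d a] sym'[of b a] sym'[of d c] sym'[of d x] by blast
  qed
  \<comment> \<open>By \<open>priv\<close> for the reversed path, \<open>?Y\<close> together with
    \<open>a\<close> and \<open>c\<close> lies in \<open>?N b - ?N a\<close>. By the degrees this
    set is no larger than \<open>?N a - ?N b\<close>, which has at most \<open>b\<close> beyond
    \<open>?X\<close>. Hence the strict inequality; reversing the path gives the opposite
    one.\<close>
  have half: "card {y \<in> V. E d y \<and> \<not> E c y \<and> y \<noteq> c} < card {x \<in> V. E a x \<and> \<not> E b x \<and> x \<noteq> b}"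
    if V: "a \<in> V" "b \<in> V" "c \<in> V" "d \<in> V"
      and path: "E a b" "E b c" "E c d" "\<not> E a c" "\<not> E b d" "\<not> E a d"
      and deg: "degree_on E V b \<le> degree_on E V a" for a b c d
  proof -
    let ?X = "{x \<in> V. E a x \<and> \<not> E b x \<and> x \<noteq> b}"
    let ?Y = "{y \<in> V. E d y \<and> \<not> E c y \<and> y \<noteq> c}"
    let ?N = "\<lambda>v. {u \<in> V. E v u}"
    have "E y b \<and> \<not> E y a" if "y \<in> ?Y" for y
      using priv[of d c b a y] V path that sym' by auto
    then have Y: "insert a (insert c ?Y) \<subseteq> ?N b - ?N a"
      using V path sym' irr by (auto simp: irreflp_def)
    have "Suc (Suc (card ?Y)) = card (insert a (insert c ?Y))"
      using fin path sym' by (subst card_insert_disjoint) auto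
    also have "\<dots> \<le> card (?N b - ?N a)"
      by (rule card_mono[OF _ Y]) (use fin in auto)
    also have "\<dots> \<le> card (?N a - ?N b)"
    proof -
      have "card (?N b - ?N a) = card (?N b) - card (?N b \<inter> ?N a)"
        "card (?N a - ?N b) = card (?N a) - card (?N b \<inter> ?N a)"
        using fin by (simp_all add: card_Diff_subset_Int Int_commute)
      then show ?thesis
        using deg unfolding degree_on_def by linarith
    qed
    also have "?N a - ?N b \<subseteq> insert b ?X"
      by auto
    then have "card (?N a - ?N b) \<le> card (insert b ?X)"
      by (intro card_mono) (use fin in auto)
    also have "\<dots> = Suc (card ?X)"
      using fin by (subst card_insert_disjoint) auto
    finally show ?thesis
      by simp
  qed
  show False
    using half[of a b c d] half[of d c b a] V path deg sym' by fastforce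
qed

section \<open>Perfect orders\<close>

text \<open>Chvatal's condition, with \<open>r\<close> as rank: an obstruction is an induced
  four-vertex path whose two ends both precede their neighbours on it.\<close>

definition perfect_order :: "('a \<Rightarrow> 'a \<Rightarrow> bool) \<Rightarrow> 'a set \<Rightarrow> ('a \<Rightarrow> nat) \<Rightarrow> bool" where
  "perfect_order E V r \<longleftrightarrow> inj_on r V \<and> (\<forall>a\<in>V. \<forall>b\<in>V. \<forall>c\<in>V. \<forall>d\<in>V.
     E a b \<and> E b c \<and> E c d \<and> \<not> E a c \<and> \<not> E b d \<and> \<not> E a d \<longrightarrow> \<not> (r a < r b \<and> r d < r c))"

lemma perfect_order_exists:
  assumes fin: "finite V" and "symp E" "irreflp E" "P5_coP5_free_on E V" "C5_free_on E V"
  obtains r where "perfect_order E V r"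
proof -
  obtain g where g: "bij_betw g V {0..<card V}"
    using ex_bij_betw_finite_nat[OF fin] by blast
  define n where "n = card V"
  \<comment> \<open>Higher degree comes first, with ties broken by the numbering \<open>g\<close>.
    As \<open>g v < n\<close>, the two summands do not interfere, and \<open>r v mod n\<close> gives
    \<open>g v\<close> back.\<close>
  define r where "r v = (n - degree_on E V v) * n + g v" for v
  have gn: "g v < n" if "v \<in> V" for v
    using bij_betwE[OF g] that unfolding n_def by auto
  have deg: "degree_on E V v \<le> n" for v
    unfolding degree_on_def n_def using fin by (intro card_mono) auto
  have "inj_on r V"
  proof (rule inj_onI)
    fix u v assume uv: "u \<in> V" "v \<in> V" "r u = r v"
    have "r w mod n = g w" if "w \<in> V" for w
      using gn[OF that] unfolding r_def by simp
    then have "g u = g v"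
      using uv by metis
    then show "u = v"
      using g uv unfolding bij_betw_def inj_on_def by blast
  qed
  moreover have mono: "degree_on E V v \<le> degree_on E V u" if "u \<in> V" "v \<in> V" "r u < r v" for u v
  proof (rule ccontr)
    assume "\<not> ?thesis"
    then have "Suc (n - degree_on E V v) \<le> n - degree_on E V u"
      using deg[of u] deg[of v] by linarith
    then have "Suc (n - degree_on E V v) * n \<le> (n - degree_on E V u) * n"
      by (rule mult_le_mono1)
    then show False
      using gn[OF that(2)] that(3) unfolding r_def by simp
  qed
  ultimately have "perfect_order E V r"
    unfolding perfect_order_def using no_obstruction[OF assms] by blast
  then show ?thesis
    by (rule that)
qed

text \<open>Chvatal's reason why greedy colouring is optimal along a perfect order. By induction, if
  no \<open>p w\<close> sees all of \<open>Q\<close>, then for each \<open>w\<close> some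
  \<open>p (s w)\<close> sees all of \<open>Q\<close> except \<open>w\<close>, and these near misses
  assemble into an obstruction.\<close>

lemma perfect_order_common_neighbour:
  assumes "finite Q" "Q \<noteq> {}" "Q \<subseteq> V" "perfect_order E V r" "symp E"
    and "\<forall>u\<in>Q. \<forall>v\<in>Q. u \<noteq> v \<longrightarrow> E u v"
    and "\<forall>w\<in>Q. p w \<in> V \<and> E (p w) w \<and> r (p w) < r w"
    and "\<forall>u\<in>Q. \<forall>v\<in>Q. \<not> E (p u) (p v)"
  shows "\<exists>w\<in>Q. \<forall>u\<in>Q. E (p w) u"
  using assms
proof (induction "card Q" arbitrary: Q rule: less_induct)
  case less
  note fin = less.prems(1) and QV = less.prems(3) and order = less.prems(4)
    and Q = less.prems(6) and p = less.prems(7) and stable = less.prems(8)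
  show ?case
  proof (rule ccontr)
    assume not: "\<not> ?case"
    have "\<exists>t\<in>Q. t \<noteq> w \<and> (\<forall>u\<in>Q - {w}. E (p t) u) \<and> \<not> E (p t) w" if w: "w \<in> Q" for w
    proof -
      have "Q - {w} \<noteq> {}"
      proof
        assume "Q - {w} = {}"
        then have "Q = {w}"
          using w by blast
        then show False
          using not p by auto
      qed
      moreover have "card (Q - {w}) < card Q"
        using w fin by (rule card_Diff1_less[rotated])
      ultimately obtain t where t: "t \<in> Q - {w}" "\<forall>u\<in>Q - {w}. E (p t) u"
        using less.hyps[of "Q - {w}"] less.prems by auto
      moreover have "\<not> E (p t) w"
        using not t by blast
      ultimately show ?thesis
        by blast
    qed
    then obtain s where s: "\<And>w. w \<in> Q \<Longrightarrow> s w \<in> Q \<and> s w \<noteq> w \<and> \<not> E (p (s w)) w"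
      "\<And>w u. w \<in> Q \<Longrightarrow> u \<in> Q \<Longrightarrow> u \<noteq> w \<Longrightarrow> E (p (s w)) u"
      by (metis Diff_iff singletonD)
    txt \<open>\<open>s\<close> is a derangement of \<open>Q\<close>; the obstruction is found at the smallest vertex \<open>p (s m)\<close>.\<close>
    have "inj_on s Q"
      using s by (intro inj_onI) metis
    then have surj: "s ` Q = Q"
      using s(1) fin by (intro endo_inj_surj) auto
    obtain x where x: "x \<in> Q" "\<And>y. y \<in> Q \<Longrightarrow> r (p x) \<le> r (p y)"
      using ex_has_least_nat[of "\<lambda>x. x \<in> Q" _ "\<lambda>x. r (p x)"] less.prems(2) by blast
    have "x \<in> s ` Q"
      using surj x(1) by simp
    then obtain m where m: "m \<in> Q" "s m = x"
      by auto
    then have "m \<in> s ` Q"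
      using surj by simp
    then obtain w where w: "w \<in> Q" "s w = m"
      by auto
    have min: "r (p (s m)) < r y" if "y \<in> Q" for y
      using x(2)[OF that] p that m(2) by (meson le_less_trans)
    \<comment> \<open>The obstruction is the path \<open>p (s m)\<close>, \<open>w\<close>,
      \<open>m\<close>, \<open>p m\<close>, where \<open>s w = m\<close>: within \<open>Q\<close>
      the first vertex misses only \<open>m\<close> and the last only \<open>w\<close>, and the two
      ends are nonadjacent by \<open>stable\<close>.\<close>
    have "w \<noteq> m" "\<not> E (p m) w" "\<not> E (p (s m)) m"
      using s(1)[OF w(1)] s(1)[OF m(1)] w(2) by auto
    moreover from this have "E (p (s m)) w" "E w m"
      using s(2)[OF m(1) w(1)] Q w m by auto
    moreover have "E (p m) m" "\<not> E (p (s m)) (p m)"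
      using p stable m s(1)[OF m(1)] by auto
    ultimately have "E (p (s m)) w \<and> E w m \<and> E m (p m) \<and> \<not> E (p (s m)) m \<and> \<not> E w (p m) \<and> \<not> E (p (s m)) (p m)"
      using sympD[OF \<open>symp E\<close>] by blast
    moreover have "p (s m) \<in> V" "p m \<in> V" "w \<in> V" "m \<in> V"
      using p m(1) w(1) s(1)[OF m(1)] QV by auto
    moreover have "r (p (s m)) < r w" "r (p m) < r m"
      using min w p m by auto
    ultimately show False
      using order unfolding perfect_order_def by meson
  qed
qed

text \<open>The second conjunct is the trace of choosing the least free colour; it supplies the
  earlier neighbours that \<open>C5_free_clique\<close> builds on. Vertices are inserted by
  increasing rank, so a new one never precedes a coloured one.\<close>

lemma greedy_coloring:
  fixes r :: "'a \<Rightarrow> nat"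
  assumes "finite V" "symp E" "irreflp E" "inj_on r V"
  shows "\<exists>c :: 'a \<Rightarrow> nat. (\<forall>u\<in>V. \<forall>v\<in>V. E u v \<longrightarrow> c u \<noteq> c v) \<and>
    (\<forall>v\<in>V. \<forall>i<c v. \<exists>u\<in>V. E u v \<and> r u < r v \<and> c u = i)"
  using assms(1,4)
proof (induction V rule: finite_ranking_induct[where f = r])
  case empty
  then show ?case by simp
next
  case (insert x S)
  then obtain c where c: "\<forall>u\<in>S. \<forall>v\<in>S. E u v \<longrightarrow> c u \<noteq> c v"
    "\<forall>v\<in>S. \<forall>i<c v. \<exists>u\<in>S. E u v \<and> r u < r v \<and> c u = (i::nat)"
    by auto
  show ?case
  proof (cases "x \<in> S")
    case True
    then show ?thesis
      using c by (intro exI[of _ c]) (simp add: insert_absorb)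
  next
    case xS: False
    have less: "r u < r x" if "u \<in> S" for u
    proof -
      have "r u \<le> r x" "u \<noteq> x"
        using insert.hyps that xS by auto
      moreover have "r u \<noteq> r x"
        using inj_onD[OF insert.prems, of u x] that \<open>u \<noteq> x\<close> by auto
      ultimately show ?thesis
        by simp
    qed
    define A where "A = c ` {u \<in> S. E u x}"
    define m where "m = (LEAST i. i \<notin> A)"
    have "finite A"
      unfolding A_def using insert.hyps by simp
    then obtain i where "i \<notin> A"
      using ex_new_if_finite[OF infinite_UNIV_nat] by blast
    then have m: "m \<notin> A" "\<And>i. i < m \<Longrightarrow> i \<in> A"
      unfolding m_def using LeastI[of "\<lambda>i. i \<notin> A"] not_less_Least[of _ "\<lambda>i. i \<notin> A"] by blast+
    show ?thesis
    proof (intro exI[of _ "c(x := m)"] conjI ballI impI allI)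
      fix u v assume "u \<in> insert x S" "v \<in> insert x S" "E u v"
      then show "(c(x := m)) u \<noteq> (c(x := m)) v"
        using c(1) m(1) assms(2,3) less unfolding A_def irreflp_def
        by (auto dest: sympD)
    next
      fix v i assume v: "v \<in> insert x S" "i < (c(x := m)) v"
      show "\<exists>u\<in>insert x S. E u v \<and> r u < r v \<and> (c(x := m)) u = i"
      proof (cases "v = x")
        case True
        then obtain u where "u \<in> S" "E u x" "c u = i"
          using m(2)[of i] v(2) unfolding A_def by auto
        then show ?thesis
          using less[of u] True by (intro bexI[of _ u]) auto
      next
        case False
        then obtain u where u: "u \<in> S" "E u v" "r u < r v" "c u = i"
          using c(2) v by auto
        then show ?thesis
          using less[of u] by (intro bexI[of _ u]) auto
      qed
    qed
  qed
qed

text \<open>\<open>m\<close> is the largest greedy colour, and a clique on \<open>m + 1\<close>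
  vertices is grown downwards through the colours from a vertex coloured \<open>m\<close>.\<close>

lemma C5_free_clique:
  assumes fin: "finite V" and sym: "symp E" and irr: "irreflp E"
    and "P5_coP5_free_on E V" "C5_free_on E V" and "V \<noteq> {}"
  obtains n Q where "colorable_on E V n" "Q \<subseteq> V" "card Q = n"
    "\<forall>u\<in>Q. \<forall>v\<in>Q. u \<noteq> v \<longrightarrow> E u v"
proof -
  obtain r where r: "perfect_order E V r"
    using perfect_order_exists[OF assms(1-5)] .
  have "inj_on r V"
    using r unfolding perfect_order_def by simp
  then obtain c :: "'a \<Rightarrow> nat" where c: "\<forall>u\<in>V. \<forall>v\<in>V. E u v \<longrightarrow> c u \<noteq> c v"
    "\<forall>v\<in>V. \<forall>i<c v. \<exists>u\<in>V. E u v \<and> r u < r v \<and> c u = i"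
    using greedy_coloring[OF fin sym irr, of r] by metis
  define m where "m = Max (c ` V)"
  have "m \<in> c ` V"
    unfolding m_def using fin \<open>V \<noteq> {}\<close> by (intro Max_in) auto
  then obtain x where x: "x \<in> V" "c x = m"
    by auto
  have "c v \<le> m" if "v \<in> V" for v
    unfolding m_def using fin that by (intro Max_ge) auto
  then have col: "colorable_on E V (Suc m)"
    unfolding colorable_on_def using c(1) by (intro exI[of _ c]) (auto simp: less_Suc_eq_le)
  \<comment> \<open>The bound \<open>m - j \<le> c v\<close> gives every clique vertex an earlier
    neighbour of the next lower colour. These neighbours share a colour, hence are pairwise
    nonadjacent, and so one of them sees the whole clique.\<close>
  have "\<exists>Q\<subseteq>V. card Q = Suc j \<and> (\<forall>u\<in>Q. \<forall>v\<in>Q. u \<noteq> v \<longrightarrow> E u v) \<and> (\<forall>v\<in>Q. m - j \<le> c v)"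
    if "j \<le> m" for j
    using that
  proof (induction j)
    case 0
    show ?case
      using x by (intro exI[of _ "{x}"]) auto
  next
    case (Suc j)
    then obtain Q where Q: "Q \<subseteq> V" "card Q = Suc j"
      "\<forall>u\<in>Q. \<forall>v\<in>Q. u \<noteq> v \<longrightarrow> E u v" "\<forall>v\<in>Q. m - j \<le> c v"
      by auto
    let ?i = "m - Suc j"
    have finQ: "finite Q" and "Q \<noteq> {}"
      using Q(2) card.infinite by fastforce+
    have "\<exists>u\<in>V. E u w \<and> r u < r w \<and> c u = ?i" if "w \<in> Q" for w
    proof -
      have "?i < c w" "w \<in> V"
        using Suc.prems Q(1,4) that by force+
      then show ?thesis
        using c(2) by simp
    qed
    then obtain p where p: "\<forall>w\<in>Q. p w \<in> V \<and> E (p w) w \<and> r (p w) < r w \<and> c (p w) = ?i"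
      by metis
    have "\<forall>u\<in>Q. \<forall>v\<in>Q. \<not> E (p u) (p v)"
      using c(1) p by metis
    then obtain w where w: "w \<in> Q" "\<forall>u\<in>Q. E (p w) u"
      using perfect_order_common_neighbour[OF finQ \<open>Q \<noteq> {}\<close> Q(1) r sym Q(3), of p] p by blast
    have "p w \<notin> Q"
      using w irr unfolding irreflp_def by blast
    have "\<forall>u\<in>insert (p w) Q. \<forall>v\<in>insert (p w) Q. u \<noteq> v \<longrightarrow> E u v"
      using Q(3) w(2) sympD[OF sym] by simp
    moreover have "insert (p w) Q \<subseteq> V" "\<forall>v\<in>insert (p w) Q. m - Suc j \<le> c v"
      using Q p w(1) by force+
    moreover have "card (insert (p w) Q) = Suc (Suc j)"
      using \<open>p w \<notin> Q\<close> finQ Q(2) by simp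
    ultimately show ?case
      by blast
  qed
  from this[OF order_refl] col that show ?thesis
    by blast
qed

text \<open>If a vertex lay outside the clique of \<open>C5_free_clique\<close>, deleting it would
  leave a clique of at least \<open>k\<close> vertices coloured with \<open>k - 1\<close> colours.
  So the clique is all of \<open>V\<close>.\<close>

lemma critical_on_C5_free:
  assumes "finite V" "symp E" "irreflp E" "P5_coP5_free_on E V" "C5_free_on E V"
    and crit: "critical_on E V k" and uv: "u \<in> V" "v \<in> V" "u \<noteq> v"
  shows "E u v"
proof -
  have "V \<noteq> {}"
    using uv(1) by auto
  obtain n Q where Q: "colorable_on E V n" "Q \<subseteq> V" "card Q = n"
    "\<forall>u\<in>Q. \<forall>v\<in>Q. u \<noteq> v \<longrightarrow> E u v"
    using C5_free_clique[OF assms(1-5) \<open>V \<noteq> {}\<close>] .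
  have "k \<le> n"
    using crit Q(1) unfolding critical_on_def by (meson not_le)
  have k: "0 < k"
    using critical_on_pos[OF crit \<open>V \<noteq> {}\<close>] .
  have "Q = V"
  proof (rule ccontr)
    assume "Q \<noteq> V"
    then obtain x where x: "x \<in> V" "Q \<subseteq> V - {x}"
      using Q(2) by blast
    obtain c where c: "c ` (V - {x}) \<subseteq> {..<k - 1}"
      "\<forall>x'\<in>V - {x}. \<forall>y\<in>V - {x}. E x' y \<longrightarrow> c x' \<noteq> c y"
      using critical_on_delete[OF crit x(1)] .
    have "inj_on c Q"
    proof (rule inj_onI, rule ccontr)
      fix y z assume "y \<in> Q" "z \<in> Q" "c y = c z" "y \<noteq> z"
      moreover from this have "E y z"
        using Q(4) by blast
      ultimately show False
        using c(2) x(2) by blast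
    qed
    moreover have "c ` Q \<subseteq> {..<k - 1}"
      using c(1) x(2) by blast
    ultimately have "card Q \<le> k - 1"
      using card_inj_on_le[of c Q "{..<k - 1}"] by simp
    then show False
      using Q(3) \<open>k \<le> n\<close> k by simp
  qed
  then show ?thesis
    using Q(4) uv by blast
qed

section \<open>Induced five-cycles\<close>

lemma is_C5_rotate: "symp E \<Longrightarrow> is_C5 E a b c d e \<Longrightarrow> is_C5 E b c d e a"
  unfolding is_C5_def by (auto dest: sympD)

lemma is_C5_reflect: "symp E \<Longrightarrow> is_C5 E a b c d e \<Longrightarrow> is_C5 E a e d c b"
  unfolding is_C5_def by (auto dest: sympD)

text \<open>The first pattern would make \<open>x a b c d\<close> an induced path, the second would
  make \<open>x a c e b\<close> the complement of one. Adjacency to \<open>e\<close> is left open in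
  the first, adjacency to \<open>d\<close> in the second.\<close>

lemma C5_attach:
  assumes "symp E" and free: "P5_coP5_free_on E V" and C5: "is_C5 E a b c d e"
    and V: "a \<in> V" "b \<in> V" "c \<in> V" "d \<in> V" "e \<in> V" "x \<in> V"
  shows "\<not> (E x a \<and> \<not> E x b \<and> \<not> E x c \<and> \<not> E x d)"
    and "\<not> (\<not> E x a \<and> E x b \<and> E x c \<and> E x e)"
proof -
  have sym': "E u v \<Longrightarrow> E v u" for u v
    by (rule sympD[OF assms(1)])
  have "\<not> is_P5 E x a b c d"
    using V by (simp add: P5_coP5_free_onD[OF free])
  then show "\<not> (E x a \<and> \<not> E x b \<and> \<not> E x c \<and> \<not> E x d)"
    using C5 unfolding is_P5_def is_C5_def by blast
  have "\<not> is_coP5 E x a c e b"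
    using V by (simp add: P5_coP5_free_onD[OF free])
  then show "\<not> (\<not> E x a \<and> E x b \<and> E x c \<and> E x e)"
    using C5 sym'[of e b] sym'[of b e] sym'[of e a] sym'[of b c]
    unfolding is_coP5_def is_C5_def by blast
qed

text \<open>The patterns of \<open>C5_attach\<close> under all rotations and reflections. What
  survives: \<open>x\<close> sees none of the cycle, all of it, or exactly the two neighbours of
  some cycle vertex, with or without that vertex.\<close>

lemma C5_attach_all:
  assumes "symp E" "P5_coP5_free_on E V" "is_C5 E a b c d e"
    and "a \<in> V" "b \<in> V" "c \<in> V" "d \<in> V" "e \<in> V" "x \<in> V"
  shows "\<not> (E x a \<and> \<not> E x b \<and> \<not> E x c \<and> \<not> E x d)" "\<not> (\<not> E x a \<and> E x b \<and> E x c \<and> E x e)"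
    "\<not> (E x b \<and> \<not> E x c \<and> \<not> E x d \<and> \<not> E x e)" "\<not> (\<not> E x b \<and> E x c \<and> E x d \<and> E x a)"
    "\<not> (E x c \<and> \<not> E x d \<and> \<not> E x e \<and> \<not> E x a)" "\<not> (\<not> E x c \<and> E x d \<and> E x e \<and> E x b)"
    "\<not> (E x d \<and> \<not> E x e \<and> \<not> E x a \<and> \<not> E x b)" "\<not> (\<not> E x d \<and> E x e \<and> E x a \<and> E x c)"
    "\<not> (E x e \<and> \<not> E x a \<and> \<not> E x b \<and> \<not> E x c)" "\<not> (\<not> E x e \<and> E x a \<and> E x b \<and> E x d)"
    "\<not> (E x a \<and> \<not> E x e \<and> \<not> E x d \<and> \<not> E x c)" "\<not> (\<not> E x a \<and> E x e \<and> E x d \<and> E x b)"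
    "\<not> (E x b \<and> \<not> E x a \<and> \<not> E x e \<and> \<not> E x d)" "\<not> (\<not> E x b \<and> E x a \<and> E x e \<and> E x c)"
    "\<not> (E x c \<and> \<not> E x b \<and> \<not> E x a \<and> \<not> E x e)" "\<not> (\<not> E x c \<and> E x b \<and> E x a \<and> E x d)"
    "\<not> (E x d \<and> \<not> E x c \<and> \<not> E x b \<and> \<not> E x a)" "\<not> (\<not> E x d \<and> E x c \<and> E x b \<and> E x e)"
    "\<not> (E x e \<and> \<not> E x d \<and> \<not> E x c \<and> \<not> E x b)" "\<not> (\<not> E x e \<and> E x d \<and> E x c \<and> E x a)"
proof -
  note rot = is_C5_rotate[OF assms(1)] and att = C5_attach[OF assms(1,2)]
    and refl = is_C5_reflect[OF assms(1)]
  note 1 = assms(3)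
  note 2 = rot[OF 1] note 3 = rot[OF 2] note 4 = rot[OF 3] note 5 = rot[OF 4]
  note V = assms(4-)
  show "\<not> (E x a \<and> \<not> E x b \<and> \<not> E x c \<and> \<not> E x d)" "\<not> (\<not> E x a \<and> E x b \<and> E x c \<and> E x e)"
    by (rule att[OF 1]; fact V)+
  show "\<not> (E x b \<and> \<not> E x c \<and> \<not> E x d \<and> \<not> E x e)" "\<not> (\<not> E x b \<and> E x c \<and> E x d \<and> E x a)"
    by (rule att[OF 2]; fact V)+
  show "\<not> (E x c \<and> \<not> E x d \<and> \<not> E x e \<and> \<not> E x a)" "\<not> (\<not> E x c \<and> E x d \<and> E x e \<and> E x b)"
    by (rule att[OF 3]; fact V)+
  show "\<not> (E x d \<and> \<not> E x e \<and> \<not> E x a \<and> \<not> E x b)" "\<not> (\<not> E x d \<and> E x e \<and> E x a \<and> E x c)"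
    by (rule att[OF 4]; fact V)+
  show "\<not> (E x e \<and> \<not> E x a \<and> \<not> E x b \<and> \<not> E x c)" "\<not> (\<not> E x e \<and> E x a \<and> E x b \<and> E x d)"
    by (rule att[OF 5]; fact V)+
  show "\<not> (E x a \<and> \<not> E x e \<and> \<not> E x d \<and> \<not> E x c)" "\<not> (\<not> E x a \<and> E x e \<and> E x d \<and> E x b)"
    by (rule att[OF refl[OF 1]]; fact V)+
  show "\<not> (E x b \<and> \<not> E x a \<and> \<not> E x e \<and> \<not> E x d)" "\<not> (\<not> E x b \<and> E x a \<and> E x e \<and> E x c)"
    by (rule att[OF refl[OF 2]]; fact V)+
  show "\<not> (E x c \<and> \<not> E x b \<and> \<not> E x a \<and> \<not> E x e)" "\<not> (\<not> E x c \<and> E x b \<and> E x a \<and> E x d)"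
    by (rule att[OF refl[OF 3]]; fact V)+
  show "\<not> (E x d \<and> \<not> E x c \<and> \<not> E x b \<and> \<not> E x a)" "\<not> (\<not> E x d \<and> E x c \<and> E x b \<and> E x e)"
    by (rule att[OF refl[OF 4]]; fact V)+
  show "\<not> (E x e \<and> \<not> E x d \<and> \<not> E x c \<and> \<not> E x b)" "\<not> (\<not> E x e \<and> E x d \<and> E x c \<and> E x a)"
    by (rule att[OF refl[OF 5]]; fact V)+
qed

text \<open>Substitutes for the missing first vertex of the cycle. Adjacency between two substitutes
  is left free.\<close>

definition C5_twins :: "('a \<Rightarrow> 'a \<Rightarrow> bool) \<Rightarrow> 'a set \<Rightarrow> 'a \<Rightarrow> 'a \<Rightarrow> 'a \<Rightarrow> 'a \<Rightarrow> 'a set" where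
  "C5_twins E V b c d e = {x \<in> V. is_C5 E x b c d e}"

lemma C5_twins_iff:
  assumes "symp E" "is_C5 E a b c d e"
  shows "x \<in> C5_twins E V b c d e \<longleftrightarrow> x \<in> V \<and> E x b \<and> \<not> E x c \<and> \<not> E x d \<and> E x e"
proof -
  have "E e x = E x e"
    using sympD[OF assms(1)] by blast
  then show ?thesis
    using assms(2) unfolding C5_twins_def is_C5_def by auto
qed

text \<open>By the surviving patterns of \<open>C5_attach_all\<close>, the adjacency of
  \<open>y\<close> to \<open>b\<close>, \<open>c\<close>, \<open>d\<close>, \<open>e\<close> decides
  its adjacency to the fifth vertex, unless \<open>y\<close> sees exactly \<open>b\<close> and
  \<open>e\<close> among these four; but then \<open>y\<close> would be a twin.\<close>

lemma homogeneous_C5_twins: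
  assumes sym: "symp E" and free: "P5_coP5_free_on E V"
    and V: "b \<in> V" "c \<in> V" "d \<in> V" "e \<in> V"
  shows "homogeneous E V (C5_twins E V b c d e)"
  unfolding homogeneous_def
proof (intro conjI ballI impI)
  show "C5_twins E V b c d e \<subseteq> V"
    unfolding C5_twins_def by blast
next
  fix y u v assume y: "y \<in> V - C5_twins E V b c d e"
    and "u \<in> C5_twins E V b c d e" "v \<in> C5_twins E V b c d e" and yu: "E y u"
  then have C5: "is_C5 E u b c d e" "is_C5 E v b c d e" and uv: "u \<in> V" "v \<in> V"
    unfolding C5_twins_def by auto
  have yV: "y \<in> V" and "\<not> (E y b \<and> \<not> E y c \<and> \<not> E y d \<and> E y e)"
    using y C5_twins_iff[OF sym C5(1)] by auto
  then show "E y v"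
    using yu C5_attach_all[OF sym free C5(1) uv(1) V yV] C5_attach_all[OF sym free C5(2) uv(2) V yV]
    by argo
qed

definition C5_buoy :: "('a \<Rightarrow> 'a \<Rightarrow> bool) \<Rightarrow> 'a set \<Rightarrow> 'a \<Rightarrow> 'a \<Rightarrow> 'a \<Rightarrow> 'a \<Rightarrow> 'a \<Rightarrow> 'a set" where
  "C5_buoy E V a b c d e = C5_twins E V b c d e \<union> C5_twins E V c d e a \<union> C5_twins E V d e a b \<union>
     C5_twins E V e a b c \<union> C5_twins E V a b c d"

text \<open>A vertex outside the five twin classes can only see all or none of the cycle, and as
  each class is a module it then sees all or none of their union.\<close>

lemma homogeneous_C5_buoy:
  assumes sym: "symp E" and free: "P5_coP5_free_on E V" and C5: "is_C5 E a b c d e"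
    and V: "a \<in> V" "b \<in> V" "c \<in> V" "d \<in> V" "e \<in> V"
  shows "homogeneous E V (C5_buoy E V a b c d e)"
proof -
  note rot = is_C5_rotate[OF sym]
  note C5s = C5 rot[OF C5] rot[OF rot[OF C5]] rot[OF rot[OF rot[OF C5]]]
    rot[OF rot[OF rot[OF rot[OF C5]]]]
  have self: "a \<in> C5_twins E V b c d e" "b \<in> C5_twins E V c d e a" "c \<in> C5_twins E V d e a b"
    "d \<in> C5_twins E V e a b c" "e \<in> C5_twins E V a b c d"
    using C5s V unfolding C5_twins_def by auto
  have adj: "E y u \<longleftrightarrow> E y a" if y: "y \<in> V - C5_buoy E V a b c d e"
    and u: "u \<in> C5_buoy E V a b c d e" for y u
  proof -
    have yV: "y \<in> V"
      using y by blast
    have notin: "y \<notin> C5_twins E V b c d e" "y \<notin> C5_twins E V c d e a" "y \<notin> C5_twins E V d e a b"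
      "y \<notin> C5_twins E V e a b c" "y \<notin> C5_twins E V a b c d"
      using y unfolding C5_buoy_def by auto
    note notin' = notin[unfolded C5_twins_iff[OF sym C5s(1)] C5_twins_iff[OF sym C5s(2)]
      C5_twins_iff[OF sym C5s(3)] C5_twins_iff[OF sym C5s(4)] C5_twins_iff[OF sym C5s(5)]]
    have eq: "E y b = E y a \<and> E y c = E y a \<and> E y d = E y a \<and> E y e = E y a"
      using C5_attach_all[OF sym free C5 V yV] notin' yV by argo
    have twin: "E y u \<longleftrightarrow> E y v"
      if "u \<in> C5_twins E V p q s t" "v \<in> C5_twins E V p q s t" "y \<notin> C5_twins E V p q s t"
        "p \<in> V" "q \<in> V" "s \<in> V" "t \<in> V" for p q s t v
      using homogeneous_C5_twins[OF sym free that(4-7)] that(1-3) yV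
      unfolding homogeneous_def by blast
    from u consider "u \<in> C5_twins E V b c d e" | "u \<in> C5_twins E V c d e a"
      | "u \<in> C5_twins E V d e a b" | "u \<in> C5_twins E V e a b c" | "u \<in> C5_twins E V a b c d"
      unfolding C5_buoy_def by blast
    then show ?thesis
    proof cases
      case 1
      show ?thesis by (rule twin[OF 1 self(1) notin(1) V(2,3,4,5)])
    next
      case 2
      show ?thesis using twin[OF 2 self(2) notin(2) V(3,4,5,1)] eq by simp
    next
      case 3
      show ?thesis using twin[OF 3 self(3) notin(3) V(4,5,1,2)] eq by simp
    next
      case 4
      show ?thesis using twin[OF 4 self(4) notin(4) V(5,1,2,3)] eq by simp
    next
      case 5
      show ?thesis using twin[OF 5 self(5) notin(5) V(1,2,3,4)] eq by simp
    qed
  qed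
  have "C5_buoy E V a b c d e \<subseteq> V"
    unfolding C5_buoy_def C5_twins_def by blast
  then show ?thesis
    unfolding homogeneous_def using adj by blast
qed

text \<open>Two vertices of \<open>K\<close> have the same neighbours elsewhere. In a
  \<open>P5\<close> or its complement every edge has a third vertex adjacent to exactly one of its
  ends, so a copy uses no added edge; its nonedges are nonedges of \<open>E\<close> too, and the
  copy already occurs in \<open>E\<close>.\<close>

lemma P5_coP5_free_add_clique:
  assumes sym: "symp E" and free: "P5_coP5_free_on E V"
    and hom: "homogeneous E V M" and K: "K \<subseteq> M"
  shows "P5_coP5_free_on (add_clique E K) (V - M \<union> K)"
proof -
  let ?E = "add_clique E K" and ?V = "V - M \<union> K"
  have MV: "M \<subseteq> V" and M: "\<And>y u v. y \<in> V - M \<Longrightarrow> u \<in> M \<Longrightarrow> v \<in> M \<Longrightarrow> E y u \<Longrightarrow> E y v"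
    using hom unfolding homogeneous_def by blast+
  note sym' = sympD[OF symp_add_clique[OF sym, of K]]
  have twin: "?E u z" if "u \<in> K" "v \<in> K" "z \<in> ?V" "z \<noteq> u" "?E v z" for u v z
  proof (cases "z \<in> K")
    case True
    then show ?thesis
      using that unfolding add_clique_def by blast
  next
    case False
    then have "z \<in> V - M" "E v z"
      using that unfolding add_clique_def by auto
    then have "E u z"
      using M[of z v u] K that(1,2) sympD[OF sym] by blast
    then show ?thesis
      unfolding add_clique_def by blast
  qed
  txt \<open>No two vertices of \<open>P5\<close> or of its complement are adjacent twins.\<close>
  have key: "E x y" if "?E x y" "?E z y" "\<not> ?E z x" "z \<noteq> x" "x \<in> ?V" "y \<in> ?V" "z \<in> ?V" for x y z
  proof (rule ccontr)
    assume "\<not> E x y"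
    then have "x \<in> K" "y \<in> K"
      using that(1) unfolding add_clique_def by auto
    then have "?E x z"
      using twin[of x y z] that sym' by blast
    then show False
      using sym' that(3) by blast
  qed
  have sub: "\<not> E x y" if "\<not> ?E x y" for x y
    using that unfolding add_clique_def by blast
  show ?thesis
    unfolding P5_coP5_free_on_def
  proof (intro ballI conjI notI)
    fix a b c d e assume V: "a \<in> ?V" "b \<in> ?V" "c \<in> ?V" "d \<in> ?V" "e \<in> ?V"
    have V': "a \<in> V" "b \<in> V" "c \<in> V" "d \<in> V" "e \<in> V"
      using V K MV by auto
    {
      assume P: "is_P5 ?E a b c d e"
      note P = P[unfolded is_P5_def]
      have non: "\<not> ?E c a" "\<not> ?E d b" "\<not> ?E e c" "c \<noteq> a" "d \<noteq> b" "e \<noteq> c" "b \<noteq> d" "\<not> ?E b d"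
        and rev: "?E c b" "?E d c" "?E e d"
        using P sym' by blast+
      have "E a b" "E b c" "E c d" "E d e"
        using key[of a b c] key[of b c d] key[of c d e] key[of e d c] sympD[OF sym, of e d] P non rev V
          sym' by auto
      then have "is_P5 E a b c d e"
        using P sub unfolding is_P5_def by simp
      then show False
        using P5_coP5_free_onD(1)[OF free V'] by simp
    next
      assume P: "is_coP5 ?E a b c d e"
      note P = P[unfolded is_coP5_def]
      have rev: "?E d a" "?E c a" "?E e a" "?E d b" "?E e b" "?E e c"
        using P sym' by blast+
      have non: "\<not> ?E b a" "\<not> ?E c b" "\<not> ?E d c" "\<not> ?E e d" 
        using P sym' by blast+
      have neq: "a \<noteq> b" "b \<noteq> c" "c \<noteq> d" "d \<noteq> e"
        using P non rev by metis+
      have 1: "E c a"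
        by (rule key[of c a d]) (use P non rev neq V in auto)
      have 2: "E d a"
        by (rule key[of d a c]) (use P non rev neq V in auto)
      have 3: "E e a"
        by (rule key[of e a d]) (use P non rev neq V in auto)
      have 4: "E d b"
        by (rule key[of d b e]) (use P non rev neq V in auto)
      have 5: "E e b"
        by (rule key[of e b d]) (use P non rev neq V in auto)
      have 6: "E c e"
        by (rule key[of c e b]) (use P non rev neq V in auto)
      have "is_coP5 E a b c d e"
        using 1 2 3 4 5 6 P sub sympD[OF sym] unfolding is_coP5_def by simp
      then show False
        using P5_coP5_free_onD(2)[OF free V'] by simp
    }
  qed
qed

section \<open>Covering a critical graph by proper modules\<close>

text \<open>Five is the number of twin classes around a five-cycle. The empty graph is covered by
  the empty family; a single vertex has no cover, its only proper module being empty.\<close>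

definition few_modules :: "('a \<Rightarrow> 'a \<Rightarrow> bool) \<Rightarrow> 'a set \<Rightarrow> bool" where
  "few_modules E V \<longleftrightarrow> (\<exists>\<F>. finite \<F> \<and> card \<F> \<le> 5 \<and> \<Union>\<F> = V \<and>
     (\<forall>M\<in>\<F>. homogeneous E V M \<and> M \<noteq> V))"

text \<open>If \<open>B\<close> is completely joined to the rest, \<open>B\<close> and
  \<open>V - B\<close> suffice. Otherwise modules are lifted: one that meets \<open>K\<close>
  receives all of \<open>B\<close> in place of its part in \<open>K\<close>, the others stay as they
  are.\<close>

lemma few_modules_add_clique:
  assumes sym: "symp E" and hom: "homogeneous E V B" and "B \<noteq> V"
    and K: "K \<subseteq> B" "K \<noteq> {}" and few: "few_modules (add_clique E K) (V - B \<union> K)"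
  shows "few_modules E V"
proof (cases "\<forall>y\<in>V - B. \<forall>u\<in>B. E y u")
  case True
  then have "homogeneous E V (V - B)"
    unfolding homogeneous_def using sympD[OF sym] by blast
  moreover have "V - B \<union> B = V" "B \<subseteq> V" "B \<noteq> {}"
    using hom K unfolding homogeneous_def by auto
  ultimately show ?thesis
    unfolding few_modules_def using hom \<open>B \<noteq> V\<close>
    by (intro exI[of _ "{V - B, B}"]) (auto simp: card_insert_if)
next
  case False
  let ?E = "add_clique E K" and ?V = "V - B \<union> K"
  have BV: "B \<subseteq> V" and B: "\<And>y u v. y \<in> V - B \<Longrightarrow> u \<in> B \<Longrightarrow> v \<in> B \<Longrightarrow> E y u \<Longrightarrow> E y v"
    using hom unfolding homogeneous_def by blast+
  have B': "E u y \<Longrightarrow> E v y" if "y \<in> V - B" "u \<in> B" "v \<in> B" for y u v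
    using B[OF that] sympD[OF sym] by blast
  obtain w u where wu: "w \<in> V - B" "u \<in> B" "\<not> E w u"
    using False by auto
  have w: "w \<in> V - B" "\<And>v. v \<in> B \<Longrightarrow> \<not> E w v"
    using wu B[OF wu(1) _ wu(2)] by auto
  have E_iff: "?E x y \<longleftrightarrow> E x y" if "x \<notin> B \<or> y \<notin> B" for x y
    using that K(1) unfolding add_clique_def by blast
  obtain \<F> where \<F>: "finite \<F>" "card \<F> \<le> 5" "\<Union>\<F> = ?V"
    "\<And>M. M \<in> \<F> \<Longrightarrow> homogeneous ?E ?V M \<and> M \<noteq> ?V"
    using few unfolding few_modules_def by (elim exE conjE) (rule that, auto)
  txt \<open>The vertex \<open>w\<close> outside \<open>B\<close> with no neighbour in \<open>B\<close> is what keeps the lifted modules proper.\<close>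
  define lift where "lift M = (M - B) \<union> (if M \<inter> K = {} then {} else B)" for M
  have lift_hom: "homogeneous E V (lift M)" and lift_neq: "lift M \<noteq> V" if M: "M \<in> \<F>" for M
  proof -
    have MV: "M \<subseteq> ?V" and hM: "\<And>y u v. y \<in> ?V - M \<Longrightarrow> u \<in> M \<Longrightarrow> v \<in> M \<Longrightarrow> ?E y u \<Longrightarrow> ?E y v"
      and neq: "M \<noteq> ?V"
      using \<F>(4)[OF M] unfolding homogeneous_def by blast+
    have lift_sub: "lift M \<subseteq> V"
      using MV BV K(1) unfolding lift_def by auto
    have "E y v" if y: "y \<in> V - lift M" and u: "u \<in> lift M" and v: "v \<in> lift M" and yu: "E y u" for y u v
    proof -
      \<comment> \<open>A member of \<open>B\<close> may be absent from the smaller graph; a vertex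
        of \<open>K\<close> inside \<open>M\<close> stands in for it.\<close>
      have rep: "\<exists>u'\<in>M. (u' = u \<and> u \<notin> B \<or> u' \<in> K \<and> u \<in> B)" if "u \<in> lift M" for u
        using that MV unfolding lift_def by (cases "u \<in> B") (auto split: if_splits)
      obtain u' where u': "u' \<in> M" "u' = u \<and> u \<notin> B \<or> u' \<in> K \<and> u \<in> B"
        using rep[OF u] by blast
      obtain v' where v': "v' \<in> M" "v' = v \<and> v \<notin> B \<or> v' \<in> K \<and> v \<in> B"
        using rep[OF v] by blast
      show ?thesis
      proof (cases "y \<in> B")
        case True
        then have "M \<inter> K = {}"
          using y unfolding lift_def by (auto split: if_splits)
        then have uv: "u \<in> M" "v \<in> M" "u \<notin> B" "v \<notin> B"
          using u v unfolding lift_def by auto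
        then have uvV: "u \<in> V - B" "v \<in> V - B"
          using MV K by auto
        \<comment> \<open>\<open>y\<close> may have been dropped, so any \<open>z\<close> in
          \<open>K\<close> takes its place in the module condition for \<open>M\<close>.\<close>
        obtain z where z: "z \<in> K" "z \<in> B"
          using K by blast
        have "E z u"
          using B'[OF uvV(1) True z(2) yu] .
        moreover have "z \<in> ?V - M"
          using z \<open>M \<inter> K = {}\<close> by auto
        ultimately have "E z v"
          using hM[of z u v] uv E_iff by blast
        then show ?thesis
          using B'[OF uvV(2) z(2) True] by blast
      next
        case False
        have yVB: "y \<in> V - B" and yM: "y \<in> ?V - M"
          using y False unfolding lift_def by auto
        have "E y u'"
          using u'(2) B[OF yVB, of u u'] yu K(1) by blast
        then have "?E y v'"
          using hM[OF yM u'(1) v'(1)] E_iff False by blast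
        then have "E y v'"
          using E_iff False by blast
        then show ?thesis
          using v'(2) B[OF yVB, of v' v] K(1) by blast
      qed
    qed
    then show "homogeneous E V (lift M)"
      unfolding homogeneous_def using lift_sub by blast
    \<comment> \<open>A module whose lift is \<open>V\<close> would contain \<open>w\<close> and a
      vertex \<open>b'\<close> of \<open>K\<close> but miss some \<open>b\<close> in
      \<open>K\<close>. Since \<open>b\<close> sees \<open>b'\<close>, it would also have to see
      \<open>w\<close>.\<close>
    show "lift M \<noteq> V"
    proof
      assume eq: "lift M = V"
      have ne: "M \<inter> K \<noteq> {}"
      proof
        assume "M \<inter> K = {}"
        then have "lift M \<inter> B = {}"
          unfolding lift_def by auto
        then show False
          using eq BV K by auto
      qed
      then obtain b' where b': "b' \<in> M" "b' \<in> K"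
        by blast
      have out: "V - B \<subseteq> M"
        using eq unfolding lift_def by (auto split: if_splits)
      then obtain b where b: "b \<in> K" "b \<notin> M"
        using neq MV by blast
      have "?E b b'"
        using b b' unfolding add_clique_def by blast
      moreover have "b \<in> ?V - M" "w \<in> M"
        using b out w(1) by auto
      ultimately have "?E b w"
        using hM[of b b' w] b'(1) by blast
      then have "E b w"
        using E_iff w(1) by blast
      then show False
        using w(2)[of b] b(1) K(1) sympD[OF sym] by blast
    qed
  qed
  have "\<Union>(lift ` \<F>) = V"
  proof
    show "\<Union>(lift ` \<F>) \<subseteq> V"
      using lift_hom unfolding homogeneous_def by blast
    show "V \<subseteq> \<Union>(lift ` \<F>)"
    proof
      fix x assume x: "x \<in> V"
      obtain z where z: "z \<in> K"
        using K(2) by blast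
      show "x \<in> \<Union>(lift ` \<F>)"
      proof (cases "x \<in> B")
        case True
        have "z \<in> \<Union>\<F>"
          using z \<F>(3) by simp
        then obtain M where M: "M \<in> \<F>" "z \<in> M"
          by blast
        then have "x \<in> lift M"
          using z True unfolding lift_def by auto
        then show ?thesis
          using M(1) by blast
      next
        case False
        then have "x \<in> \<Union>\<F>"
          using x \<F>(3) by simp
        then obtain M where M: "M \<in> \<F>" "x \<in> M"
          by blast
        then have "x \<in> lift M"
          using False unfolding lift_def by auto
        then show ?thesis
          using M(1) by blast
      qed
    qed
  qed
  moreover have "card (lift ` \<F>) \<le> 5"
    using card_image_le[OF \<F>(1), of lift] \<F>(2) by linarith
  ultimately show ?thesis
    unfolding few_modules_def using \<F>(1) lift_hom lift_neq
    by (intro exI[of _ "lift ` \<F>"]) auto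
qed

text \<open>The twin classes are the cover. Every member of a class sees the first argument of that
  class, which therefore lies outside it.\<close>

lemma few_modules_C5_buoy:
  assumes sym: "symp E" and irr: "irreflp E" and free: "P5_coP5_free_on E V"
    and C5: "is_C5 E a b c d e"
    and V: "a \<in> V" "b \<in> V" "c \<in> V" "d \<in> V" "e \<in> V"
    and buoy: "C5_buoy E V a b c d e = V"
  shows "few_modules E V"
proof -
  let ?\<F> = "{C5_twins E V b c d e, C5_twins E V c d e a, C5_twins E V d e a b,
    C5_twins E V e a b c, C5_twins E V a b c d}"
  have neq: "C5_twins E V p q s t \<noteq> V" if "p \<in> V" for p q s t
  proof -
    have "p \<notin> C5_twins E V p q s t"
      using irr unfolding C5_twins_def is_C5_def irreflp_def by simp
    then show ?thesis
      using that by blast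
  qed
  have "card ?\<F> \<le> 5"
    using card_length[of "[C5_twins E V b c d e, C5_twins E V c d e a, C5_twins E V d e a b,
      C5_twins E V e a b c, C5_twins E V a b c d]"] by simp
  moreover have "\<Union>?\<F> = V"
    using buoy unfolding C5_buoy_def by (simp add: Un_assoc)
  ultimately show ?thesis
    unfolding few_modules_def using V homogeneous_C5_twins[OF sym free] neq
    by (intro exI[of _ ?\<F>]) simp
qed

lemma critical_on_few_modules:
  assumes "finite V" "symp E" "irreflp E" "P5_coP5_free_on E V" "critical_on E V k" "card V \<noteq> 1"
  shows "few_modules E V"
  using assms
proof (induction "card V" arbitrary: E V rule: less_induct)
  case less
  note fin = less.prems(1) and sym = less.prems(2) and irr = less.prems(3)
    and free = less.prems(4) and crit = less.prems(5)
  show ?case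
  proof (cases "C5_free_on E V")
    case True
    have E: "E u v" if "u \<in> V" "v \<in> V" "u \<noteq> v" for u v
      using critical_on_C5_free[OF fin sym irr free True crit that] .
    show ?thesis
    proof (cases "V = {}")
      case True
      then show ?thesis
        unfolding few_modules_def by (intro exI[of _ "{}"]) simp
    next
      case False
      then obtain v where v: "v \<in> V"
        by blast
      have "V \<noteq> {v}"
        using less.prems(6) by auto
      moreover have "homogeneous E V {v}" "homogeneous E V (V - {v})"
        unfolding homogeneous_def using E v by auto
      ultimately show ?thesis
        unfolding few_modules_def using v
        by (intro exI[of _ "{{v}, V - {v}}"]) (auto simp: card_insert_if)
    qed
  next
    case False
    then obtain a b c d e where C5: "is_C5 E a b c d e"
      and V: "a \<in> V" "b \<in> V" "c \<in> V" "d \<in> V" "e \<in> V"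
      unfolding C5_free_on_def by blast
    define B where "B = C5_buoy E V a b c d e"
    have hom: "homogeneous E V B"
      unfolding B_def by (rule homogeneous_C5_buoy[OF sym free C5 V])
    then have finB: "finite B"
      using fin unfolding homogeneous_def by (auto intro: finite_subset)
    show ?thesis
    proof (cases "B = V")
      case True
      then show ?thesis
        using few_modules_C5_buoy[OF sym irr free C5 V] unfolding B_def by simp
    next
      case neq: False
      have ac: "a \<in> B" "c \<in> B" "\<not> E a c" "a \<noteq> c"
        using C5 V is_C5_rotate[OF sym is_C5_rotate[OF sym C5]]
        unfolding B_def C5_buoy_def C5_twins_def by (auto simp: is_C5_def)
      obtain j where j: "critical_on E B j"
        using critical_on_homogeneous[OF fin sym crit hom neq] .
      have "0 < j"
        using critical_on_pos[OF j] ac(1) by blast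
      \<comment> \<open>The nonadjacent \<open>a\<close> and \<open>c\<close> can share a colour, so
        \<open>j < card B\<close>, and keeping only \<open>j\<close> vertices of \<open>B\<close>
        makes the graph strictly smaller.\<close>
      have "colorable_on E B (card B - 1)"
        using colorable_on_nonadjacent[OF finB irr sym ac(1,2,4,3)] .
      then have "j \<le> card B - 1"
        using j unfolding critical_on_def by (meson not_le)
      then have "j < card B"
        using \<open>0 < j\<close> by simp
      then obtain K where K: "K \<subseteq> B" "card K = j" "finite K"
        using obtain_subset_with_card_n[of j B] finB finite_subset[of _ B] by (metis less_imp_le)
      have "K \<noteq> {}"
        using K \<open>0 < j\<close> by auto
      let ?V = "V - B \<union> K"
      have BV: "B \<subseteq> V"
        using hom unfolding homogeneous_def by blast
      have cardV: "card V = card (V - B) + card B"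
        using card_Diff_subset[OF finB BV] card_mono[OF fin BV] by simp
      have card': "card ?V = card (V - B) + j"
        using K fin by (subst card_Un_disjoint) auto
      have "0 < card (V - B)"
        using neq BV fin by (auto simp: card_gt_0_iff)
      have "few_modules (add_clique E K) ?V"
      proof (rule less.hyps)
        show "card ?V < card V"
          using cardV card' \<open>j < card B\<close> by simp
        show "card ?V \<noteq> 1"
          using card' \<open>0 < j\<close> \<open>0 < card (V - B)\<close> by simp
        show "critical_on (add_clique E K) ?V k"
          by (rule critical_on_add_clique[OF fin sym irr crit hom neq j K(1,2)])
        show "P5_coP5_free_on (add_clique E K) ?V"
          by (rule P5_coP5_free_add_clique[OF sym free hom K(1)])
      qed (use fin K(3) symp_add_clique[OF sym] irreflp_add_clique[OF irr] in auto)
      then show ?thesis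
        using few_modules_add_clique[OF sym hom neq K(1) \<open>K \<noteq> {}\<close>] by blast
    qed
  qed
qed

section \<open>The bound on the number of vertices\<close>

lemma P5_coP5_free_on_subset:
  "P5_coP5_free_on E V \<Longrightarrow> W \<subseteq> V \<Longrightarrow> P5_coP5_free_on E W"
  unfolding P5_coP5_free_on_def by blast

text \<open>Each of the at most five covering modules is critical for some \<open>j < k\<close>, so
  by induction it has at most \<open>5 ^ (k - 1)\<close> vertices.\<close>

lemma card_critical_on_le:
  assumes "finite V" "symp E" "irreflp E" "P5_coP5_free_on E V" "critical_on E V k"
  shows "card V \<le> 5 ^ k"
  using assms
proof (induction k arbitrary: V rule: less_induct)
  case (less k)
  note fin = less.prems(1)
  show ?case
  proof (cases "card V \<le> 1")
    case True
    then show ?thesis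
      using one_le_power[of "5::nat" k] by linarith
  next
    case False
    then obtain l where k: "k = Suc l"
      using critical_on_pos[OF less.prems(5)] by (metis One_nat_def card.empty gr0_implies_Suc zero_le_one)
    obtain \<F> where \<F>: "finite \<F>" "card \<F> \<le> 5" "\<Union>\<F> = V"
      "\<And>M. M \<in> \<F> \<Longrightarrow> homogeneous E V M \<and> M \<noteq> V"
      using critical_on_few_modules[OF less.prems] False unfolding few_modules_def by auto
    have "card M \<le> 5 ^ l" if M: "M \<in> \<F>" for M
    proof -
      obtain j where j: "j < k" "critical_on E M j"
        using critical_on_homogeneous[OF less.prems(1,2,5)] \<F>(4)[OF M] by blast
      have MV: "M \<subseteq> V"
        using \<F>(3) M by blast
      have "card M \<le> 5 ^ j"
        by (rule less.IH[OF j(1) finite_subset[OF MV fin] less.prems(2,3)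
              P5_coP5_free_on_subset[OF less.prems(4) MV] j(2)])
      also have "\<dots> \<le> 5 ^ l"
        using j(1) k by (intro power_increasing) simp_all
      finally show ?thesis .
    qed
    then have "card (\<Union>\<F>) \<le> card \<F> * 5 ^ l"
      using card_Union_le_sum_card[of \<F>] sum_bounded_above[of \<F> card "5 ^ l"] by force
    also have "\<dots> \<le> 5 * 5 ^ l"
      using \<F>(2) by simp
    finally show ?thesis
      using \<F>(3) k by simp
  qed
qed

section \<open>Finitely many isomorphism classes\<close>

abbreviation adj :: "'a pair_pre_digraph \<Rightarrow> 'a \<Rightarrow> 'a \<Rightarrow> bool" where
  "adj G u v \<equiv> (u, v) \<in> parcs G"

definition induced_on :: "'a pair_pre_digraph \<Rightarrow> 'a set \<Rightarrow> 'a pair_pre_digraph" where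
  "induced_on G W = \<lparr> pverts = W, parcs = parcs G \<inter> W \<times> W \<rparr>"

lemma pair_graph_adj:
  assumes "pair_graph G"
  shows "finite (pverts G)" "symp (adj G)" "irreflp (adj G)" "parcs G \<subseteq> pverts G \<times> pverts G"
proof -
  interpret pair_graph G by fact
  show "finite (pverts G)"
    by simp
  show "symp (adj G)"
    by (rule sympI) (rule arcs_symmetric)
  show "irreflp (adj G)"
    using no_loops by (force intro!: irreflpI)
  show "parcs G \<subseteq> pverts G \<times> pverts G"
    by (auto dest: in_arcsD1 in_arcsD2)
qed

lemma pair_wf_digraph_iff: "pair_wf_digraph G \<longleftrightarrow> parcs G \<subseteq> pverts G \<times> pverts G"
  unfolding pair_wf_digraph_def by auto

lemma induced_subgraph_induced_on:
  assumes "pair_graph G" "W \<subseteq> pverts G"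
  shows "induced_subgraph (with_proj (induced_on G W)) (with_proj G)"
proof -
  have "wf_digraph (with_proj G)" "wf_digraph (with_proj (induced_on G W))"
    using pair_graph_adj(4)[OF assms(1)]
    by (auto simp: wf_digraph_wp_iff pair_wf_digraph_iff induced_on_def)
  then show ?thesis
    using assms(2) unfolding induced_subgraph_def subgraph_def compatible_def
    by (auto simp: induced_on_def)
qed

lemma colorable_iff_colorable_on:
  assumes "parcs G \<subseteq> pverts G \<times> pverts G"
  shows "colorable n G \<longleftrightarrow> colorable_on (adj G) (pverts G) n"
  unfolding colorable_def colorable_on_def using assms
  by (intro ex_cong1) (fastforce simp: image_subset_iff)

lemma critical_on_if_critical:
  assumes G: "pair_graph G" and crit: "critical k G"
  shows "critical_on (adj G) (pverts G) k"
proof -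
  note * = pair_graph_adj[OF G]
  \<comment> \<open>The \<open>LEAST\<close> in \<open>chromatic_number\<close> is informative only
    once some colouring exists; one colour per vertex provides it.\<close>
  have "colorable_on (adj G) (pverts G) (card (pverts G))"
    using colorable_on_card_le[OF *(1,3) order_refl] .
  then have ex: "colorable (card (pverts G)) G"
    by (simp add: colorable_iff_colorable_on[OF *(4)])
  have k: "k = (LEAST n. colorable n G)"
    using crit unfolding critical_def chromatic_number_def by simp
  have "colorable k G" "\<And>j. j < k \<Longrightarrow> \<not> colorable j G"
    using LeastI[of "\<lambda>n. colorable n G", OF ex] not_less_Least[of _ "\<lambda>n. colorable n G"]
    unfolding k by blast+
  moreover have "colorable_on (adj G) (pverts G - {v}) (k - 1)" if v: "v \<in> pverts G" for v
  proof -
    let ?H = "induced_on G (pverts G - {v})"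
    have "?H \<noteq> G"
      using v unfolding induced_on_def by (metis Diff_iff insertI1 pair_pre_digraph.select_convs(1))
    moreover have "induced_subgraph (with_proj ?H) (with_proj G)"
      by (rule induced_subgraph_induced_on[OF G]) blast
    ultimately have "colorable (k - 1) ?H"
      using crit unfolding critical_def by blast
    then have "colorable_on (adj ?H) (pverts ?H) (k - 1)"
      by (subst (asm) colorable_iff_colorable_on) (auto simp: induced_on_def)
    then show ?thesis
      unfolding colorable_on_def induced_on_def by auto
  qed
  ultimately show ?thesis
    unfolding critical_on_def by (simp add: colorable_iff_colorable_on[OF *(4)])
qed

lemma not_induced_free:
  assumes G: "pair_graph G" and F: "parcs F \<subseteq> pverts F \<times> pverts F"
    and f: "inj_on f (pverts F)" "f ` pverts F \<subseteq> pverts G"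
      "\<And>u v. u \<in> pverts F \<Longrightarrow> v \<in> pverts F \<Longrightarrow> adj F u v \<longleftrightarrow> adj G (f u) (f v)"
  shows "\<not> induced_free F G"
proof -
  let ?H = "induced_on G (f ` pverts F)"
  have wf: "pair_wf_digraph F"
    using F by (simp add: pair_wf_digraph_iff)
  have "parcs ?H = map_prod f f ` parcs F"
  proof
    show "parcs ?H \<subseteq> map_prod f f ` parcs F"
      using f(3) unfolding induced_on_def by force
    show "map_prod f f ` parcs F \<subseteq> parcs ?H"
      using F f(3) unfolding induced_on_def by fastforce
  qed
  then have "digraph_iso (with_proj F) (with_proj ?H)"
    unfolding digraph_iso_with_proj_iff[OF wf] using f(1)
    by (intro exI[of _ f]) (simp add: induced_on_def bij_betw_def)
  then have "digraph_iso (with_proj ?H) (with_proj F)"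
    by (rule digraph_iso_swap[rotated]) (simp add: wf wf_digraph_wp_iff)
  then show ?thesis
    unfolding induced_free_def using induced_subgraph_induced_on[OF G f(2)] by blast
qed

lemma less_5_iff: "(i::nat) < 5 \<longleftrightarrow> i = 0 \<or> i = 1 \<or> i = 2 \<or> i = 3 \<or> i = 4"
  by auto

lemma P5_coP5_free_on_if_P5_coP5_free:
  assumes G: "pair_graph G" and free: "P5_coP5_free G"
  shows "P5_coP5_free_on (adj G) (pverts G)"
  unfolding P5_coP5_free_on_def
proof (intro ballI conjI notI)
  fix a b c d e assume V: "a \<in> pverts G" "b \<in> pverts G" "c \<in> pverts G" "d \<in> pverts G" "e \<in> pverts G"
  \<comment> \<open>One map serves both cases, because \<open>is_coP5\<close> lists its vertices in
    the order of the complementary path.\<close>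
  let ?f = "\<lambda>i. [a, b, c, d, e] ! i"
  have sym: "adj G u v = adj G v u" for u v
    using sympD[OF pair_graph_adj(2)[OF G]] by blast
  have irr: "\<not> adj G u u" for u
    using pair_graph_adj(3)[OF G] unfolding irreflp_def by simp
  have V': "?f ` {..<5} \<subseteq> pverts G"
    using V by (auto simp: less_5_iff)
  {
    assume P: "is_P5 (adj G) a b c d e"
    note P = P[unfolded is_P5_def]
    have P': "adj G b a" "\<not> adj G c a" "\<not> adj G d a" "\<not> adj G e a" "adj G c b"
      "\<not> adj G d b" "\<not> adj G e b" "adj G d c" "\<not> adj G e c" "adj G e d"
      using P sym by blast+
    have "distinct [a, b, c, d, e]"
      using P P' irr by (simp, intro conjI notI; simp)
    then have inj: "inj_on ?f {..<5}"
      by (intro inj_on_nth) auto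
    have "\<not> induced_free (path_graph 5) G"
    proof (rule not_induced_free[OF G, of _ ?f])
      fix u v :: nat assume "u \<in> pverts (path_graph 5)" "v \<in> pverts (path_graph 5)"
      then show "adj (path_graph 5) u v \<longleftrightarrow> adj G (?f u) (?f v)"
        unfolding path_graph_def by (simp add: less_5_iff, elim disjE; simp add: P P' irr)
    qed (use inj V' in \<open>auto simp: path_graph_def\<close>)
    then show False
      using free unfolding P5_coP5_free_def by simp
  next
    assume P: "is_coP5 (adj G) a b c d e"
    note P = P[unfolded is_coP5_def]
    have P': "\<not> adj G b a" "adj G c a" "adj G d a" "adj G e a" "\<not> adj G c b"
      "adj G d b" "adj G e b" "\<not> adj G d c" "adj G e c" "\<not> adj G e d"
      using P sym by blast+
    have "distinct [a, b, c, d, e]"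
      using P P' irr by (simp, intro conjI notI; simp)
    then have inj: "inj_on ?f {..<5}"
      by (intro inj_on_nth) auto
    have "\<not> induced_free (complement_graph (path_graph 5)) G"
    proof (rule not_induced_free[OF G, of _ ?f])
      fix u v :: nat
      assume "u \<in> pverts (complement_graph (path_graph 5))" "v \<in> pverts (complement_graph (path_graph 5))"
      then show "adj (complement_graph (path_graph 5)) u v \<longleftrightarrow> adj G (?f u) (?f v)"
        unfolding complement_graph_def path_graph_def by (simp add: less_5_iff, elim disjE; simp add: P P' irr)
    qed (use inj V' in \<open>auto simp: path_graph_def complement_graph_def\<close>)
    then show False
      using free unfolding P5_coP5_free_def by simp
  }
qed

text \<open>Vertices come from an arbitrary type, so each graph is renumbered on an initial segment
  of the naturals. There are finitely many such codes, and graphs with equal codes are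
  isomorphic.\<close>

lemma finite_iso_classes:
  fixes \<G> :: "'a pair_pre_digraph set"
  assumes \<G>: "\<And>G. G \<in> \<G> \<Longrightarrow> pair_graph G" "\<And>G. G \<in> \<G> \<Longrightarrow> card (pverts G) \<le> n"
  shows "finite (\<G> // graph_iso_rel)"
proof -
  have "\<exists>f. bij_betw f (pverts G) {0..<card (pverts G)}" if "G \<in> \<G>" for G
    using ex_bij_betw_finite_nat pair_graph_adj(1)[OF \<G>(1)[OF that]] .
  then obtain f where f: "\<And>G. G \<in> \<G> \<Longrightarrow> bij_betw (f G) (pverts G) {0..<card (pverts G)}"
    by metis
  define code where "code G = ({0..<card (pverts G)}, map_prod (f G) (f G) ` parcs G)" for G
  have "code ` \<G> \<subseteq> Pow {..<n} \<times> Pow ({..<n} \<times> {..<n})"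
  proof
    fix x assume "x \<in> code ` \<G>"
    then obtain G where G: "G \<in> \<G>" "x = code G"
      by blast
    have fn: "f G u < n" if "u \<in> pverts G" for u
    proof -
      have "f G u < card (pverts G)"
        using bij_betwE[OF f[OF G(1)]] that by simp
      then show ?thesis
        using \<G>(2)[OF G(1)] by simp
    qed
    show "x \<in> Pow {..<n} \<times> Pow ({..<n} \<times> {..<n})"
    proof -
      have "map_prod (f G) (f G) ` parcs G \<subseteq> {..<n} \<times> {..<n}"
        using pair_graph_adj(4)[OF \<G>(1)[OF G(1)]] fn by (auto simp: map_prod_def)
      moreover have "{0..<card (pverts G)} \<subseteq> {..<n}"
        using \<G>(2)[OF G(1)] by auto
      ultimately show ?thesis
        unfolding G(2) code_def by simp
    qed
  qed
  then have fin: "finite (code ` \<G>)"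
    by (rule finite_subset) simp
  have same_class: "graph_iso_rel `` {G} = graph_iso_rel `` {H}"
    if GH: "G \<in> \<G>" "H \<in> \<G>" "code G = code H" for G H
  proof -
    \<comment> \<open>The common code, read as a graph on \<open>nat\<close>, is isomorphic to both
      \<open>G\<close> and \<open>H\<close> and so links them.\<close>
    let ?C = "\<lparr> pverts = fst (code G), parcs = snd (code G) \<rparr>"
    have wf: "pair_wf_digraph G" "pair_wf_digraph H"
      using pair_graph_adj(4) \<G>(1) GH(1,2) by (auto simp: pair_wf_digraph_iff)
    have "digraph_iso (with_proj G) (with_proj ?C)"
      unfolding digraph_iso_with_proj_iff[OF wf(1)]
      using f[OF GH(1)] by (intro exI[of _ "f G"]) (simp add: code_def)
    moreover have "digraph_iso (with_proj H) (with_proj ?C)"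
      unfolding digraph_iso_with_proj_iff[OF wf(2)] GH(3)
      using f[OF GH(2)] by (intro exI[of _ "f H"]) (simp add: code_def)
    then have "digraph_iso (with_proj ?C) (with_proj H)"
      by (rule digraph_iso_swap[rotated]) (simp add: wf(2) wf_digraph_wp_iff)
    ultimately have "digraph_iso (with_proj G) (with_proj H)"
      by (rule digraph_iso_trans)
    then have "(G, H) \<in> graph_iso_rel"
      using \<G>(1) GH unfolding graph_iso_rel_def by simp
    then show ?thesis
      by (rule equiv_class_eq[OF equiv_graph_iso_rel])
  qed
  let ?R = "\<lambda>x. graph_iso_rel `` {inv_into \<G> code x}"
  have "\<G> // graph_iso_rel \<subseteq> ?R ` code ` \<G>"
  proof
    fix X assume "X \<in> \<G> // graph_iso_rel"
    then obtain G where G: "G \<in> \<G>" and X: "X = graph_iso_rel `` {G}"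
      by (rule quotientE)
    have code: "code G \<in> code ` \<G>"
      using G by (rule imageI)
    have "X = ?R (code G)"
      unfolding X by (rule same_class[OF G inv_into_into[OF code] f_inv_into_f[OF code, symmetric]])
    then show "X \<in> ?R ` code ` \<G>"
      using code by (rule image_eqI)
  qed
  then show ?thesis
    by (rule finite_subset) (intro finite_imageI fin)
qed

theorem theorem2:
  fixes k :: nat
  assumes "k \<ge> 1"
  shows "finite ({G :: 'a pair_pre_digraph. pair_graph G \<and> critical k G \<and> P5_coP5_free G}
                   // graph_iso_rel)"
proof (rule finite_iso_classes[of _ "5 ^ k"])
  fix G :: "'a pair_pre_digraph"
  assume "G \<in> {G. pair_graph G \<and> critical k G \<and> P5_coP5_free G}"
  then show "pair_graph G" and "card (pverts G) \<le> 5 ^ k"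
    using card_critical_on_le[OF pair_graph_adj(1-3) P5_coP5_free_on_if_P5_coP5_free
        critical_on_if_critical] by blast+
qed

end
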